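(* Let $\Bbbk$ be a field, $\mathbf{P}$ a finite poset, $A=\Bbbk[\mathbf{P}]$, $M\in\operatorname{mod}A$ a persistence module over $\mathbf{P}$, and $I$ an interval of $\mathbf{P}$. If $\xi$ is a compression system for $A$, then $$\operatorname{mult}^\xi_I\,\delta^\xi(M)=\operatorname{mult}^\xi_I M .$$ Moreover, if $\xi$ is a rank compression system for $A$, then $$\operatorname{rank}^\xi_I\,\delta^\xi(M)=\operatorname{rank}^\xi_I M .$$
   Context: Incidence category and modules: $\Bbbk[\mathbf{P}]$ is the $\Bbbk$-linear category with object set $\mathbf{P}$, with $\Bbbk[\mathbf{P}](x,y)=\Bbbk p_{y,x}$ (one-dimensional) if $x\le y$ and $0$ otherwise, composition $p_{z,y}p_{y,x}=p_{z,x}$ and identities $p_{x,x}$. An order-preserving map $f$ induces a linear functor $\Bbbk[f]$ by $x\mapsto f(x)$, $p_{y,x}\mapsto p_{f(y),f(x)}$. $\operatorname{mod}\Bbbk[\mathbf{P}]$ is the category of $\Bbbk$-linear functors $\Bbbk[\mathbf{P}]\to\operatorname{mod}\Bbbk$ (finite-dimensional vector spaces); its objects are persistence modules over $\mathbf{P}$. Intervals: a nonempty full subposet $I\subseteq\mathbf{P}$ is an interval if it is connected (any two elements are joined by a finite sequence in $I$ whose consecutive elements are comparable) and convex ($x\le z\le y$ with $x,y\in I$ implies $z\in I$). $\mathbb{I}$ is the set of all intervals, ordered by inclusion ($I\le J\iff I\subseteq J$). $\operatorname{sc}(I)$, $\operatorname{sk}(I)$ are the sets of minimal and maximal elements of $I$.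 A segment is $[x,y]=\{z\mid x\le z\le y\}$ with $x\le y$. The interval module $V_I$ has $V_I(x)=\Bbbk$ for $x\in I$, $0$ otherwise, and $V_I(p_{y,x})=\mathrm{id}_\Bbbk$ if $x\le y$ are both in $I$, $0$ otherwise. Compression systems: a compression system $\xi=(\xi_I)_{I\in\mathbb{I}}$ for $A$ is a family of order-preserving maps $\xi_I\colon I^\xi\to\mathbf{P}$ from connected (nonempty) finite posets $I^\xi$ such that for all $I$: (1) the image of $\xi_I$ is contained in $I$; (2) the image of $\xi_I$ contains $\operatorname{sc}(I)\cup\operatorname{sk}(I)$. It is a rank compression system if moreover (3) whenever $I=[x,y]$ is a segment, there are $x'\le y'$ in $I^\xi$ with $\xi_I(x')=x$, $\xi_I(y')=y$. The restriction functor is $R_I\colon\operatorname{mod}A\to\operatorname{mod}\Bbbk[I^\xi]$, $M\mapsto M\circ\Bbbk[\xi_I]$; the module $R_I(V_I)$ is indecomposable. Multiplicities: $c^\xi_M(I)=\operatorname{mult}^\xi_I M$ is the multiplicity of the indecomposable module $R_I(V_I)$ as a direct summand in the indecomposable decomposition of $R_I(M)$. If $\xi$ is a rank compression system, put $\operatorname{rank}^\xi_I M:=c^\xi_M(I)$. Interval replacement: $\operatorname{Cov}(I)=\{L\in\mathbb{I}\mid I<L,\ \text{no interval lies strictly between } I \text{ and } L\}$. For nonempty $S\subseteq\operatorname{Cov}(I)$, $\bigvee S$ is the least upper bound of $S$ in $\mathbb{I}$ (it exists), and $\bigvee\emptyset:=I$. The signed interval multiplicity is $\delta^\xi_M(I)=\sum_{S\subseteq\operatorname{Cov}(I)}(-1)^{|S|}c^\xi_M(\bigvee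 S)$. Let $K^{\oplus}(A)$ be the split Grothendieck group of $\operatorname{mod}A$, with $[\![N]\!]$ the class of $N$. Put $\delta^\xi(M)_+=\bigoplus_{\delta^\xi_M(I)>0}V_I^{\delta^\xi_M(I)}$, $\delta^\xi(M)_-=\bigoplus_{\delta^\xi_M(I)<0}V_I^{-\delta^\xi_M(I)}$, and $\delta^\xi(M)=[\![\delta^\xi(M)_+]\!]-[\![\delta^\xi(M)_-]\!]\in K^\oplus(A)$ (the interval replacement of $M$). Finally $\operatorname{mult}^\xi_I\delta^\xi(M):=\operatorname{mult}^\xi_I\delta^\xi(M)_+-\operatorname{mult}^\xi_I\delta^\xi(M)_-$, and, for a rank compression system, $\operatorname{rank}^\xi_I\delta^\xi(M):=\operatorname{rank}^\xi_I\delta^\xi(M)_+-\operatorname{rank}^\xi_I\delta^\xi(M)_-$. *)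

theory Defs
  imports Complex_Main "HOL-Library.Function_Algebras"
begin

section \<open>Posets and intervals\<close>

text \<open>
  A poset is given by its order relation \<open>r\<close>, a set of pairs with \<open>(x, y) \<in> r\<close> iff
  \<open>x \<le> y\<close>, such that \<^const>\<open>Partial_order\<close> \<open>r\<close> holds; by reflexivity its underlying set is
  \<^const>\<open>Field\<close> \<open>r\<close>.
\<close>

definition connected_in :: "'p rel \<Rightarrow> 'p set \<Rightarrow> bool" where
  "connected_in r S \<longleftrightarrow> (\<forall>x\<in>S. \<forall>y\<in>S. (x, y) \<in> ((r \<union> r\<inverse>) \<inter> S \<times> S)\<^sup>*)"

definition convex_in :: "'p rel \<Rightarrow> 'p set \<Rightarrow> bool" where
  "convex_in r S \<longleftrightarrow> (\<forall>x\<in>S. \<forall>y\<in>S. \<forall>z. (x, z) \<in> r \<and> (z, y) \<in> r \<longrightarrow> z \<in> S)"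

definition interval :: "'p rel \<Rightarrow> 'p set \<Rightarrow> bool" where
  "interval r I \<longleftrightarrow> I \<subseteq> Field r \<and> I \<noteq> {} \<and> connected_in r I \<and> convex_in r I"

definition minimals :: "'p rel \<Rightarrow> 'p set \<Rightarrow> 'p set" where
  "minimals r I = {x \<in> I. \<forall>y\<in>I. (y, x) \<in> r \<longrightarrow> y = x}"

definition maximals :: "'p rel \<Rightarrow> 'p set \<Rightarrow> 'p set" where
  "maximals r I = {x \<in> I. \<forall>y\<in>I. (x, y) \<in> r \<longrightarrow> y = x}"

definition segment :: "'p rel \<Rightarrow> 'p \<Rightarrow> 'p \<Rightarrow> 'p set" where
  "segment r x y = {z. (x, z) \<in> r \<and> (z, y) \<in> r}"

definition Cov :: "'p rel \<Rightarrow> 'p set \<Rightarrow> 'p set set" where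
  "Cov r I = {L. interval r L \<and> I \<subset> L \<and> \<not> (\<exists>J. interval r J \<and> I \<subset> J \<and> J \<subset> L)}"

text \<open>The join of \<open>S \<subseteq> Cov r I\<close> in the poset of intervals; the empty join is \<open>I\<close> by convention.\<close>

definition interval_join :: "'p rel \<Rightarrow> 'p set \<Rightarrow> 'p set set \<Rightarrow> 'p set" where
  "interval_join r I S =
     (if S = {} then I
      else (THE L. interval r L \<and> (\<forall>J\<in>S. J \<subseteq> L) \<and>
                   (\<forall>L'. interval r L' \<and> (\<forall>J\<in>S. J \<subseteq> L') \<longrightarrow> L \<subseteq> L')))"


section \<open>Persistence modules\<close>

text \<open>
  A morphism \<open>a p\<^sub>y\<^sub>,\<^sub>x\<close> from \<open>x\<close> to \<open>y\<close> of the incidence category is encoded by its coefficient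
  \<open>a\<close>, so that composition is multiplication of coefficients and the identity of \<open>x\<close> is \<open>1\<close>.
\<close>

definition inc_hom :: "'p rel \<Rightarrow> 'p \<Rightarrow> 'p \<Rightarrow> 'k::field set" where
  "inc_hom r x y = (if (x, y) \<in> r then UNIV else {0})"

text \<open>
  The vector spaces \<open>space M x\<close> are finite-dimensional subspaces of one ambient vector space on
  the type \<open>'v\<close>, with scalar multiplication \<open>scal M\<close>; a finite family of vector spaces always
  embeds in its direct sum.  \<open>act M y x a\<close> is the linear map \<open>M(a p\<^sub>y\<^sub>,\<^sub>x)\<close> from \<open>space M x\<close> to
  \<open>space M y\<close>.
\<close>

record ('p, 'k, 'v) pmod =
  scal :: "'k \<Rightarrow> 'v \<Rightarrow> 'v"
  space :: "'p \<Rightarrow> 'v set"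
  act :: "'p \<Rightarrow> 'p \<Rightarrow> 'k \<Rightarrow> 'v \<Rightarrow> 'v"

definition linear_between ::
  "('k \<Rightarrow> 'v \<Rightarrow> 'v) \<Rightarrow> 'v set \<Rightarrow> ('k \<Rightarrow> 'w \<Rightarrow> 'w) \<Rightarrow> 'w set \<Rightarrow> ('v::ab_group_add \<Rightarrow> 'w::ab_group_add) \<Rightarrow> bool"
  where
  "linear_between s V t W f \<longleftrightarrow>
     f ` V \<subseteq> W \<and> (\<forall>u\<in>V. \<forall>v\<in>V. f (u + v) = f u + f v) \<and> (\<forall>c. \<forall>v\<in>V. f (s c v) = t c (f v))"

definition pmodule :: "'p rel \<Rightarrow> ('p, 'k::field, 'v::ab_group_add) pmod \<Rightarrow> bool" where
  "pmodule r M \<longleftrightarrow>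
     vector_space (scal M) \<and>
     (\<forall>x\<in>Field r. \<exists>B. finite B \<and> space M x = module.span (scal M) B) \<and>
     (\<forall>x\<in>Field r. \<forall>y\<in>Field r. \<forall>a\<in>inc_hom r x y.
        linear_between (scal M) (space M x) (scal M) (space M y) (act M y x a)) \<and>
     (\<forall>x\<in>Field r. \<forall>y\<in>Field r. \<forall>a\<in>inc_hom r x y. \<forall>b\<in>inc_hom r x y. \<forall>v\<in>space M x.
        act M y x (a + b) v = act M y x a v + act M y x b v) \<and>
     (\<forall>x\<in>Field r. \<forall>y\<in>Field r. \<forall>a\<in>inc_hom r x y. \<forall>c. \<forall>v\<in>space M x.
        act M y x (c * a) v = scal M c (act M y x a v)) \<and>
     (\<forall>x\<in>Field r. \<forall>v\<in>space M x. act M x x 1 v = v) \<and>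
     (\<forall>x\<in>Field r. \<forall>y\<in>Field r. \<forall>z\<in>Field r. \<forall>a\<in>inc_hom r x y. \<forall>b\<in>inc_hom r y z. \<forall>v\<in>space M x.
        act M z x (b * a) v = act M z y b (act M y x a v))"

definition pmod_iso ::
  "'p rel \<Rightarrow> ('p, 'k::field, 'v::ab_group_add) pmod \<Rightarrow> ('p, 'k, 'w::ab_group_add) pmod \<Rightarrow> bool"
  where
  "pmod_iso r M N \<longleftrightarrow>
     (\<exists>\<phi>. (\<forall>x\<in>Field r. linear_between (scal M) (space M x) (scal N) (space N x) (\<phi> x) \<and>
                       bij_betw (\<phi> x) (space M x) (space N x)) \<and>
          (\<forall>x\<in>Field r. \<forall>y\<in>Field r. \<forall>a\<in>inc_hom r x y. \<forall>v\<in>space M x.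
             \<phi> y (act M y x a v) = act N y x a (\<phi> x v)))"

definition pmod_zero :: "'p rel \<Rightarrow> ('p, 'k::field, 'v::ab_group_add) pmod \<Rightarrow> bool" where
  "pmod_zero r M \<longleftrightarrow> (\<forall>x\<in>Field r. space M x = {0})"

text \<open>The external direct sum of the modules \<open>F i\<close>, \<open>i \<in> J\<close>, which is only used for finite \<open>J\<close>.\<close>

definition pmod_dsum ::
  "'i set \<Rightarrow> ('i \<Rightarrow> ('p, 'k::field, 'v::ab_group_add) pmod) \<Rightarrow> ('p, 'k, 'i \<Rightarrow> 'v) pmod"
  where
  "pmod_dsum J F =
     \<lparr>scal = (\<lambda>c f i. scal (F i) c (f i)),
      space = (\<lambda>x. {f. (\<forall>i\<in>J. f i \<in> space (F i) x) \<and> (\<forall>i. i \<notin> J \<longrightarrow> f i = 0)}),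
      act = (\<lambda>y x a f i. if i \<in> J then act (F i) y x a (f i) else 0)\<rparr>"

text \<open>
  It suffices to let the summands live on the same type \<open>'v\<close> as the module itself, since every
  direct summand is isomorphic to a submodule.
\<close>

definition indecomposable :: "'p rel \<Rightarrow> ('p, 'k::field, 'v::ab_group_add) pmod \<Rightarrow> bool" where
  "indecomposable r M \<longleftrightarrow>
     pmodule r M \<and> \<not> pmod_zero r M \<and>
     (\<forall>F :: bool \<Rightarrow> ('p, 'k, 'v) pmod.
        (\<forall>b. pmodule r (F b)) \<and> pmod_iso r M (pmod_dsum UNIV F) \<longrightarrow> (\<exists>b. pmod_zero r (F b)))"

definition indec_decomposition ::
  "'p rel \<Rightarrow> ('p, 'k::field, 'v::ab_group_add) pmod \<Rightarrow> nat \<Rightarrow> (nat \<Rightarrow> ('p, 'k, 'v) pmod) \<Rightarrow> bool"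
  where
  "indec_decomposition r M n F \<longleftrightarrow>
     (\<forall>i<n. indecomposable r (F i)) \<and> pmod_iso r M (pmod_dsum {..<n} F)"

text \<open>
  The multiplicity of an indecomposable module \<open>X\<close> in \<open>M\<close>: the number of summands isomorphic to
  \<open>X\<close> in a decomposition of \<open>M\<close> into indecomposables, which by the Krull-Schmidt theorem does not
  depend on the decomposition.
\<close>

definition multiplicity_in ::
  "'p rel \<Rightarrow> ('p, 'k::field, 'w::ab_group_add) pmod \<Rightarrow> ('p, 'k, 'v::ab_group_add) pmod \<Rightarrow> nat"
  where
  "multiplicity_in r X M =
     (THE m. \<exists>n F. indec_decomposition r M n F \<and> m = card {i. i < n \<and> pmod_iso r (F i) X})"

text \<open>On a morphism \<open>a p\<^sub>y\<^sub>,\<^sub>x\<close> with \<open>x\<close> not below \<open>y\<close> one has \<open>a = 0\<close>, so no case distinction is needed.\<close>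

definition interval_module :: "'p set \<Rightarrow> ('p, 'k::field, 'k) pmod" where
  "interval_module I =
     \<lparr>scal = (*),
      space = (\<lambda>x. if x \<in> I then UNIV else {0}),
      act = (\<lambda>y x a v. if x \<in> I \<and> y \<in> I then a * v else 0)\<rparr>"

text \<open>Precomposition with the linear functor induced by an order-preserving map \<open>f\<close>.\<close>

definition pmod_restrict :: "('q \<Rightarrow> 'p) \<Rightarrow> ('p, 'k, 'v) pmod \<Rightarrow> ('q, 'k, 'v) pmod" where
  "pmod_restrict f M =
     \<lparr>scal = scal M, space = (\<lambda>x. space M (f x)), act = (\<lambda>y x. act M (f y) (f x))\<rparr>"


section \<open>Compression systems\<close>

text \<open>
  \<open>cposet \<xi> I\<close> is (the order relation of) the poset \<open>I\<^sup>\<xi>\<close> and \<open>cmap \<xi> I\<close> is the map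
  \<open>\<xi>\<^sub>I\<close>.  Only the values at intervals \<open>I\<close> matter.
\<close>

record ('p, 'q) csys =
  cposet :: "'p set \<Rightarrow> 'q rel"
  cmap :: "'p set \<Rightarrow> 'q \<Rightarrow> 'p"

definition compression_system :: "'p rel \<Rightarrow> ('p, 'q) csys \<Rightarrow> bool" where
  "compression_system r \<xi> \<longleftrightarrow>
     (\<forall>I. interval r I \<longrightarrow>
        Partial_order (cposet \<xi> I) \<and>
        finite (Field (cposet \<xi> I)) \<and>
        Field (cposet \<xi> I) \<noteq> {} \<and>
        connected_in (cposet \<xi> I) (Field (cposet \<xi> I)) \<and>
        (\<forall>x y. (x, y) \<in> cposet \<xi> I \<longrightarrow> (cmap \<xi> I x, cmap \<xi> I y) \<in> r) \<and>
        cmap \<xi> I ` Field (cposet \<xi> I) \<subseteq> I \<and>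
        minimals r I \<union> maximals r I \<subseteq> cmap \<xi> I ` Field (cposet \<xi> I))"

definition rank_compression_system :: "'p rel \<Rightarrow> ('p, 'q) csys \<Rightarrow> bool" where
  "rank_compression_system r \<xi> \<longleftrightarrow>
     compression_system r \<xi> \<and>
     (\<forall>x y. (x, y) \<in> r \<longrightarrow>
        (\<exists>x' y'. (x', y') \<in> cposet \<xi> (segment r x y) \<and>
                 cmap \<xi> (segment r x y) x' = x \<and> cmap \<xi> (segment r x y) y' = y))"

definition compression_mult ::
  "('p, 'q) csys \<Rightarrow> 'p set \<Rightarrow> ('p, 'k::field, 'v::ab_group_add) pmod \<Rightarrow> nat"
  where
  "compression_mult \<xi> I M =
     multiplicity_in (cposet \<xi> I)
       (pmod_restrict (cmap \<xi> I) (interval_module I :: ('p, 'k, 'k) pmod))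
       (pmod_restrict (cmap \<xi> I) M)"

text \<open>The rank is only ever considered for rank compression systems.\<close>

definition compression_rank ::
  "('p, 'q) csys \<Rightarrow> 'p set \<Rightarrow> ('p, 'k::field, 'v::ab_group_add) pmod \<Rightarrow> nat"
  where
  "compression_rank \<xi> I M = compression_mult \<xi> I M"


section \<open>Interval replacement\<close>

definition signed_interval_mult ::
  "'p rel \<Rightarrow> ('p, 'q) csys \<Rightarrow> ('p, 'k::field, 'v::ab_group_add) pmod \<Rightarrow> 'p set \<Rightarrow> int"
  where
  "signed_interval_mult r \<xi> M I =
     (\<Sum>S\<in>Pow (Cov r I). (-1) ^ card S * int (compression_mult \<xi> (interval_join r I S) M))"

text \<open>The direct sum over all intervals \<open>J\<close> of \<open>nat (d J)\<close> copies of the interval module of \<open>J\<close>.\<close>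

definition interval_dsum ::
  "'p rel \<Rightarrow> ('p set \<Rightarrow> int) \<Rightarrow> ('p, 'k::field, 'p set \<times> nat \<Rightarrow> 'k) pmod"
  where
  "interval_dsum r d =
     pmod_dsum {(J, k). interval r J \<and> k < nat (d J)} (\<lambda>(J, k). interval_module J)"

text \<open>
  An element \<open>[N\<^sub>+] - [N\<^sub>-]\<close> of the split Grothendieck group is given by the pair
  \<open>(N\<^sub>+, N\<^sub>-)\<close>.  The interval replacement comes with its positive and its negative part, and
  its multiplicities and ranks are defined from these two modules.
\<close>

definition interval_replacement ::
  "'p rel \<Rightarrow> ('p, 'q) csys \<Rightarrow> ('p, 'k::field, 'v::ab_group_add) pmod \<Rightarrow>
   ('p, 'k, 'p set \<times> nat \<Rightarrow> 'k) pmod \<times> ('p, 'k, 'p set \<times> nat \<Rightarrow> 'k) pmod"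
  where
  "interval_replacement r \<xi> M =
     (interval_dsum r (signed_interval_mult r \<xi> M),
      interval_dsum r (\<lambda>J. - signed_interval_mult r \<xi> M J))"

definition virtual_mult ::
  "('p, 'q) csys \<Rightarrow> 'p set \<Rightarrow>
   ('p, 'k::field, 'v::ab_group_add) pmod \<times> ('p, 'k, 'w::ab_group_add) pmod \<Rightarrow> int"
  where
  "virtual_mult \<xi> I D = int (compression_mult \<xi> I (fst D)) - int (compression_mult \<xi> I (snd D))"

definition virtual_rank ::
  "('p, 'q) csys \<Rightarrow> 'p set \<Rightarrow>
   ('p, 'k::field, 'v::ab_group_add) pmod \<times> ('p, 'k, 'w::ab_group_add) pmod \<Rightarrow> int"
  where
  "virtual_rank \<xi> I D = int (compression_rank \<xi> I (fst D)) - int (compression_rank \<xi> I (snd D))"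

end

theory Submission
  imports Defs
begin

text \<open>
  The alternating sums over covers invert summation over the intervals containing \<open>I\<close>, for an
  arbitrary function in place of \<open>c\<^sub>M\<close>: joins of covers exist, and for an interval \<open>L\<close> strictly
  above \<open>I\<close> the signs of the nonempty sets of covers of \<open>I\<close> below \<open>L\<close> add up to \<open>-1\<close>.

  It remains to see that \<open>V\<^sub>J\<close> has multiplicity \<open>1\<close> at \<open>I\<close> if \<open>I \<subseteq> J\<close> and \<open>0\<close> otherwise, and that
  multiplicities are additive on sums of interval modules.  The module \<open>R\<^sub>I(V\<^sub>I)\<close> is constant on a
  connected poset, so its endomorphism ring is the field, and its multiplicity in \<open>N\<close> is the rank
  of the pairing between the homomorphisms from it to \<open>N\<close> and back.  If \<open>I \<subseteq> J\<close>, then \<open>R\<^sub>I(V\<^sub>J)\<close>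
  is the constant module; otherwise some minimal or maximal element of \<open>I\<close> lies outside \<open>J\<close>,
  where \<open>R\<^sub>I(V\<^sub>J)\<close> vanishes, so the pairing is zero.
\<close>

subsection \<open>Intervals of a finite poset\<close>

lemma finite_intervals:
  assumes "finite (Field r)"
  shows "finite {J. interval r J}"
  by (rule finite_subset[of _ "Pow (Field r)"]) (use assms in \<open>auto simp: interval_def\<close>)

lemma finite_Cov:
  assumes "finite (Field r)"
  shows "finite (Cov r I)"
  by (rule finite_subset[OF _ finite_intervals[OF assms]]) (auto simp: Cov_def)

text \<open>Among the elements of \<open>I\<close> below \<open>x\<close>, one with the fewest
  elements of \<open>I\<close> below it is minimal, since anything strictly smaller would have a
  smaller down-set. Applied to the converse order, this also yields maximal elements.\<close>

lemma exists_minimal_below: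
  assumes r: "Partial_order r" and I: "finite I" "I \<subseteq> Field r" and x: "x \<in> I"
  shows "\<exists>a\<in>minimals r I. (a, x) \<in> r"
proof -
  let ?D = "\<lambda>y. {z \<in> I. (z, y) \<in> r}"
  have refl: "(y, y) \<in> r" if "y \<in> I" for y
    using r I that by (auto simp: partial_order_on_def preorder_on_def refl_on_def)
  have trans: "trans r" and anti: "antisym r"
    using r by (auto simp: partial_order_on_def preorder_on_def)
  obtain a where a: "a \<in> I" "(a, x) \<in> r"
    and least: "\<And>b. b \<in> I \<Longrightarrow> (b, x) \<in> r \<Longrightarrow> card (?D a) \<le> card (?D b)"
    using ex_has_least_nat[of "\<lambda>y. y \<in> I \<and> (y, x) \<in> r" x "\<lambda>y. card (?D y)"] x refl by auto
  have "b = a" if b: "b \<in> I" "(b, a) \<in> r" for b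
  proof (rule ccontr)
    assume "b \<noteq> a"
    then have "a \<notin> ?D b"
      using b anti by (auto dest: antisymD)
    moreover have "a \<in> ?D a"
      using a refl by auto
    moreover have "?D b \<subseteq> ?D a"
      using b trans by (auto dest: transD)
    ultimately have "card (?D b) < card (?D a)"
      using I by (intro psubset_card_mono) auto
    then show False
      using least[of b] b a trans by (meson transD not_le)
  qed
  with a show ?thesis
    by (auto simp: minimals_def)
qed

text \<open>Each element of \<open>I\<close> lies between a minimal and a maximal one, so convexity
  of \<open>J\<close> captures it. Used in contrapositive form: if \<open>J\<close> does not contain
  \<open>I\<close>, it misses an extreme element of \<open>I\<close>, which a compression system
  must hit.\<close>

lemma interval_subset_if_extremes:
  assumes r: "Partial_order r" and fin: "finite (Field r)" and I: "interval r I" and J: "interval r J"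
    and sub: "minimals r I \<union> maximals r I \<subseteq> J"
  shows "I \<subseteq> J"
proof
  fix x assume x: "x \<in> I"
  have IF: "I \<subseteq> Field r" and fI: "finite I"
    using I fin finite_subset by (auto simp: interval_def)
  obtain a where a: "a \<in> minimals r I" "(a, x) \<in> r"
    using exists_minimal_below[OF r fI IF x] by blast
  obtain b where b: "b \<in> minimals (r\<inverse>) I" "(b, x) \<in> r\<inverse>"
    using exists_minimal_below[of "r\<inverse>" I x] r fI IF x by auto
  have "b \<in> maximals r I"
    using b by (auto simp: minimals_def maximals_def)
  then have "a \<in> J" "b \<in> J"
    using a sub by auto
  then show "x \<in> J"
    using a b J unfolding interval_def convex_in_def by blast
qed

lemma connected_in_mono_rtrancl:
  assumes "A \<subseteq> B" "(x, y) \<in> ((r \<union> r\<inverse>) \<inter> A \<times> A)\<^sup>*"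
  shows "(x, y) \<in> ((r \<union> r\<inverse>) \<inter> B \<times> B)\<^sup>*"
  using assms rtrancl_mono[of "(r \<union> r\<inverse>) \<inter> A \<times> A" "(r \<union> r\<inverse>) \<inter> B \<times> B"] by blast

lemma comparability_rtrancl_sym:
  "(x, y) \<in> ((r \<union> r\<inverse>) \<inter> A \<times> A)\<^sup>* \<Longrightarrow> (y, x) \<in> ((r \<union> r\<inverse>) \<inter> A \<times> A)\<^sup>*"
  by (rule symD[OF sym_rtrancl]) (auto simp: sym_def)

text \<open>The convex hull of the union of the members of \<open>S\<close>, which share a point, is their join.\<close>

lemma exists_interval_join:
  assumes r: "Partial_order r" and S: "S \<noteq> {}" "\<And>J. J \<in> S \<Longrightarrow> interval r J \<and> a \<in> J"
  shows "\<exists>L. interval r L \<and> (\<forall>J\<in>S. J \<subseteq> L) \<and>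
    (\<forall>L'. interval r L' \<and> (\<forall>J\<in>S. J \<subseteq> L') \<longrightarrow> L \<subseteq> L')"
proof -
  define L where "L = {z. \<exists>x\<in>\<Union>S. \<exists>y\<in>\<Union>S. (x, z) \<in> r \<and> (z, y) \<in> r}"
  have trans: "trans r" and refl: "refl_on (Field r) r"
    using r by (auto simp: partial_order_on_def preorder_on_def)
  have sub: "\<Union>S \<subseteq> L"
  proof
    fix x assume x: "x \<in> \<Union>S"
    then have "x \<in> Field r"
      using S(2) by (auto simp: interval_def)
    then have "(x, x) \<in> r"
      using refl by (auto simp: refl_on_def)
    with x show "x \<in> L"
      unfolding L_def by blast
  qed
  have aL: "a \<in> L"
    using S sub by blast
  \<comment> \<open>A point \<open>x\<close> of the hull is comparable to some \<open>y\<close> in a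
    member \<open>J\<close> of \<open>S\<close>, and \<open>J\<close> connects \<open>y\<close> to
    the common point \<open>a\<close>; so every point of \<open>L\<close> is joined to
    \<open>a\<close>.\<close>
  have hub: "(x, a) \<in> ((r \<union> r\<inverse>) \<inter> L \<times> L)\<^sup>*" if x: "x \<in> L" for x
  proof -
    obtain y J where y: "J \<in> S" "y \<in> J" "(y, x) \<in> r"
      using x unfolding L_def by blast
    have "(y, a) \<in> ((r \<union> r\<inverse>) \<inter> J \<times> J)\<^sup>*"
      using S(2)[OF y(1)] y(2) by (auto simp: interval_def connected_in_def)
    then have "(y, a) \<in> ((r \<union> r\<inverse>) \<inter> L \<times> L)\<^sup>*"
      by (rule connected_in_mono_rtrancl[rotated]) (use sub y in blast)
    moreover have "(x, y) \<in> (r \<union> r\<inverse>) \<inter> L \<times> L"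
      using y sub x by blast
    ultimately show ?thesis
      by (rule converse_rtrancl_into_rtrancl[rotated])
  qed
  have "connected_in r L"
    unfolding connected_in_def by (intro ballI rtrancl_trans[OF hub comparability_rtrancl_sym[OF hub]])
  moreover have "convex_in r L"
    unfolding convex_in_def L_def using trans by (blast dest: transD)
  moreover have "L \<subseteq> Field r"
    unfolding L_def by (auto intro: FieldI1 FieldI2)
  ultimately have "interval r L"
    using aL by (auto simp: interval_def)
  moreover have "L \<subseteq> L'" if "interval r L'" "\<forall>J\<in>S. J \<subseteq> L'" for L'
  proof -
    have "\<Union>S \<subseteq> L'"
      using that by blast
    then show ?thesis
      using that(1) unfolding interval_def convex_in_def L_def by blast
  qed
  ultimately show ?thesis
    using sub by blast
qed

text \<open>Sets of covers of \<open>I\<close> share the points of \<open>I\<close>, so their joins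
  exist, and antisymmetry of inclusion makes the description by \<open>THE\<close> unique. The
  conjunct \<open>I \<subseteq> L\<close> in the last property lets it cover the empty join
  \<open>I\<close> too.\<close>

lemma interval_join_properties:
  assumes r: "Partial_order r" and I: "interval r I" and S: "S \<subseteq> Cov r I"
  shows interval_interval_join: "interval r (interval_join r I S)"
    and interval_join_psubset: "S \<noteq> {} \<Longrightarrow> I \<subset> interval_join r I S"
    and interval_join_subset_iff:
      "interval r L \<Longrightarrow> interval_join r I S \<subseteq> L \<longleftrightarrow> I \<subseteq> L \<and> (\<forall>J\<in>S. J \<subseteq> L)"
proof -
  have *: "interval r (interval_join r I S) \<and> (\<forall>J\<in>S. J \<subseteq> interval_join r I S) \<and>
    (\<forall>L. interval r L \<and> (\<forall>J\<in>S. J \<subseteq> L) \<longrightarrow> interval_join r I S \<subseteq> L)" if ne: "S \<noteq> {}"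
  proof -
    obtain a where a: "a \<in> I"
      using I by (auto simp: interval_def)
    have "\<exists>L. interval r L \<and> (\<forall>J\<in>S. J \<subseteq> L) \<and>
      (\<forall>L'. interval r L' \<and> (\<forall>J\<in>S. J \<subseteq> L') \<longrightarrow> L \<subseteq> L')"
      by (rule exists_interval_join[OF r ne, of a]) (use S a in \<open>unfold Cov_def, blast\<close>)
    then have "\<exists>!L. interval r L \<and> (\<forall>J\<in>S. J \<subseteq> L) \<and>
      (\<forall>L'. interval r L' \<and> (\<forall>J\<in>S. J \<subseteq> L') \<longrightarrow> L \<subseteq> L')"
      by (elim ex_ex1I) (intro subset_antisym; simp)
    from theI'[OF this] show ?thesis
      using ne by (simp add: interval_join_def)
  qed
  have up: "I \<subset> J" if "J \<in> S" for J
    using subsetD[OF S that] by (simp add: Cov_def)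
  show "interval r (interval_join r I S)"
    using * I by (cases "S = {}") (simp_all add: interval_join_def)
  show psub: "I \<subset> interval_join r I S" if ne: "S \<noteq> {}"
  proof -
    obtain J where J: "J \<in> S"
      using ne by blast
    then have "J \<subseteq> interval_join r I S"
      using *[OF ne] by simp
    then show ?thesis
      using up[OF J] by (rule psubset_subset_trans[rotated])
  qed
  show "interval_join r I S \<subseteq> L \<longleftrightarrow> I \<subseteq> L \<and> (\<forall>J\<in>S. J \<subseteq> L)" if "interval r L"
  proof (cases "S = {}")
    case True
    then show ?thesis by (simp add: interval_join_def)
  next
    case False
    have "I \<subseteq> interval_join r I S"
      using psub[OF False] by (rule psubset_imp_subset)
    moreover have "\<forall>J\<in>S. J \<subseteq> interval_join r I S"
      using *[OF False] by simp
    ultimately show ?thesis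
      using *[OF False] that subset_trans[of _ "interval_join r I S" L] by (intro iffI) simp_all
  qed
qed

text \<open>An interval of least cardinality among those strictly above \<open>I\<close> and inside
  \<open>L\<close> is a cover of \<open>I\<close>.\<close>

lemma exists_cover_below:
  assumes fin: "finite (Field r)" and L: "interval r L" "I \<subset> L"
  shows "\<exists>J\<in>Cov r I. J \<subseteq> L"
proof -
  let ?P = "\<lambda>J. interval r J \<and> I \<subset> J \<and> J \<subseteq> L"
  obtain J where J: "?P J" and least: "\<And>K. ?P K \<Longrightarrow> card J \<le> card K"
    using ex_has_least_nat[of ?P L card] L by auto
  have "\<not> K \<subset> J" if "interval r K" "I \<subset> K" for K
  proof
    assume "K \<subset> J"
    moreover have "finite J"
      using J fin finite_subset by (auto simp: interval_def)
    ultimately have "card K < card J"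
      by (simp add: psubset_card_mono)
    moreover have "card J \<le> card K"
      using least[of K] that \<open>K \<subset> J\<close> J by (meson order_trans psubset_imp_subset)
    ultimately show False
      by simp
  qed
  then have "\<not> (\<exists>K. interval r K \<and> I \<subset> K \<and> K \<subset> J)"
    by iprover
  then have "J \<in> Cov r I"
    using J by (simp add: Cov_def)
  moreover have "J \<subseteq> L"
    using J by simp
  ultimately show ?thesis ..
qed

subsection \<open>Inversion of the alternating sums over covers\<close>

text \<open>This is the expansion of the product of \<open>1 - 1\<close> over
  \<open>A\<close>.\<close>

lemma sum_Pow_minus_one_power_card:
  assumes "finite A"
  shows "(\<Sum>S\<in>Pow A. (-1) ^ card S) = (if A = {} then 1 else (0::int))"
proof -
  have "(\<Sum>S\<in>Pow A. (-1) ^ card S) = (\<Prod>x\<in>A. (1::int) - 1)"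
    by (subst prod_diff_conv_sum) (use assms in auto)
  then show ?thesis
    using assms by (simp add: power_0_left)
qed

text \<open>The induction runs from large intervals to small ones. In \<open>d I\<close> every
  nonempty set of covers contributes \<open>c\<close> at a strictly larger interval, which the
  induction hypothesis rewrites as a sum of values of \<open>d\<close>; exchanging the sums then
  leaves a sign count for each interval \<open>L\<close> above \<open>I\<close>.\<close>

lemma sum_cover_signs_above:
  fixes c :: "'p set \<Rightarrow> int"
  assumes r: "Partial_order r" and fin: "finite (Field r)" and I: "interval r I"
  shows "(\<Sum>J | interval r J \<and> I \<subseteq> J. \<Sum>S\<in>Pow (Cov r J). (-1) ^ card S * c (interval_join r J S)) = c I"
  using I
proof (induction "card (Field r) - card I" arbitrary: I rule: less_induct)
  case less
  note I = less.prems
  let ?up = "\<lambda>I. {J. interval r J \<and> I \<subseteq> J}"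
  define d where "d J = (\<Sum>S\<in>Pow (Cov r J). (-1) ^ card S * c (interval_join r J S))" for J
  have finC: "finite (Cov r I)" and finI: "finite {J. interval r J}"
    using fin by (simp_all add: finite_Cov finite_intervals)
  have finup: "finite (?up I)"
    by (rule finite_subset[OF _ finI]) auto
  have IH: "c J = sum d (?up J)" if J: "interval r J" "I \<subset> J" for J
  proof -
    have "J \<subseteq> Field r"
      using J by (auto simp: interval_def)
    then have "finite J" "card J \<le> card (Field r)"
      using fin by (auto intro: finite_subset card_mono)
    moreover from this J have "card I < card J"
      by (simp add: psubset_card_mono)
    ultimately show ?thesis
      using less.hyps[of J] J by (simp add: d_def)
  qed
  \<comment> \<open>The sets counted here are the nonempty subsets of \<open>?A\<close>, the covers
    of \<open>I\<close> inside \<open>L\<close>. All subsets together have sign sum 0 unless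
    \<open>?A\<close> is empty, and dropping the empty set subtracts 1.\<close>
  have signs: "(\<Sum>S | S \<in> Pow (Cov r I) \<and> S \<noteq> {} \<and> interval_join r I S \<subseteq> L. (-1) ^ card S) =
      (if L = I then 0 else -1 :: int)" if L: "L \<in> ?up I" for L
  proof -
    let ?A = "{J \<in> Cov r I. J \<subseteq> L}"
    have "interval_join r I S \<subseteq> L \<longleftrightarrow> S \<subseteq> ?A" if "S \<subseteq> Cov r I" for S
      using interval_join_subset_iff[OF r I that, of L] L that by (simp add: subset_eq[of S])
    then have "{S. S \<in> Pow (Cov r I) \<and> S \<noteq> {} \<and> interval_join r I S \<subseteq> L} = Pow ?A - {{}}"
      by (intro set_eqI) (simp, blast)
    then have "(\<Sum>S | S \<in> Pow (Cov r I) \<and> S \<noteq> {} \<and> interval_join r I S \<subseteq> L. (-1) ^ card S) =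
      (\<Sum>S\<in>Pow ?A. (-1) ^ card S) - (1::int)"
      using finC by (simp add: sum_diff1)
    moreover have "?A = {} \<longleftrightarrow> L = I"
    proof
      show "L = I" if empty: "?A = {}"
      proof (rule ccontr)
        assume "L \<noteq> I"
        with L have "interval r L" "I \<subset> L"
          by auto
        from exists_cover_below[OF fin this] empty show False
          by simp
      qed
      show "?A = {}" if "L = I"
        using that unfolding Cov_def by (blast dest: psubset_subset_trans)
    qed
    ultimately show ?thesis
      using finC by (simp add: sum_Pow_minus_one_power_card)
  qed
  \<comment> \<open>The summand split off is the one for \<open>S = {}\<close>, whose join is
    \<open>I\<close> by convention.\<close>
  have "d I = c I + (\<Sum>S\<in>Pow (Cov r I) - {{}}. (-1) ^ card S * c (interval_join r I S))"
    unfolding d_def using finC by (subst sum.remove[of _ "{}"]) (auto simp: interval_join_def)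
  also have "(\<Sum>S\<in>Pow (Cov r I) - {{}}. (-1) ^ card S * c (interval_join r I S)) =
    (\<Sum>S\<in>Pow (Cov r I) - {{}}. \<Sum>L | L \<in> ?up I \<and> interval_join r I S \<subseteq> L. (-1) ^ card S * d L)"
  proof (rule sum.cong[OF refl])
    fix S assume S: "S \<in> Pow (Cov r I) - {{}}"
    have "c (interval_join r I S) = sum d (?up (interval_join r I S))"
      using S by (intro IH interval_interval_join[OF r I] interval_join_psubset[OF r I]) auto
    also have "?up (interval_join r I S) = {L. L \<in> ?up I \<and> interval_join r I S \<subseteq> L}"
      using S interval_join_psubset[OF r I, of S] by auto
    finally show "(-1) ^ card S * c (interval_join r I S) =
      (\<Sum>L | L \<in> ?up I \<and> interval_join r I S \<subseteq> L. (-1) ^ card S * d L)"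
      by (simp add: sum_distrib_left)
  qed
  also have "\<dots> = (\<Sum>L\<in>?up I. \<Sum>S | S \<in> Pow (Cov r I) - {{}} \<and> interval_join r I S \<subseteq> L.
      (-1) ^ card S * d L)"
    using finC finup by (intro sum.swap_restrict) auto
  also have "\<dots> = (\<Sum>L\<in>?up I. (if L = I then 0 else -1) * d L)"
    by (intro sum.cong refl) (simp add: signs[symmetric] sum_distrib_right conj_assoc)
  also have "\<dots> = (\<Sum>L\<in>?up I - {I}. - d L)"
    using finup I by (subst sum.remove[of _ I]) (auto intro: sum.cong)
  finally have "d I = c I - sum d (?up I - {I})"
    by (simp add: sum_negf)
  moreover have "sum d (?up I) = d I + sum d (?up I - {I})"
    using finup I by (subst sum.remove[of _ I]) auto
  ultimately have "sum d (?up I) = c I"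
    by simp
  then show ?case
    by (simp add: d_def)
qed

subsection \<open>Homomorphisms of persistence modules\<close>

lemma pmoduleD:
  assumes "pmodule r M"
  shows pmodule_vector_space: "vector_space (scal M)"
    and pmodule_finite_span: "x \<in> Field r \<Longrightarrow> \<exists>B. finite B \<and> space M x = module.span (scal M) B"
    and pmodule_act_in: "x \<in> Field r \<Longrightarrow> y \<in> Field r \<Longrightarrow> a \<in> inc_hom r x y \<Longrightarrow> v \<in> space M x \<Longrightarrow>
      act M y x a v \<in> space M y"
    and pmodule_act_add: "x \<in> Field r \<Longrightarrow> y \<in> Field r \<Longrightarrow> a \<in> inc_hom r x y \<Longrightarrow> v \<in> space M x \<Longrightarrow>
      w \<in> space M x \<Longrightarrow> act M y x a (v + w) = act M y x a v + act M y x a w"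
  using assms unfolding pmodule_def linear_between_def image_subset_iff by auto

lemma pmodule_subspace:
  assumes "pmodule r M" "x \<in> Field r"
  shows "module.subspace (scal M) (space M x)"
proof -
  interpret vector_space "scal M"
    by (rule pmodule_vector_space[OF assms(1)])
  show ?thesis
    using pmodule_finite_span[OF assms] subspace_span by metis
qed

lemma
  assumes M: "pmodule r M" "x \<in> Field r"
  shows pmodule_space_zero: "0 \<in> space M x"
    and pmodule_space_add: "v \<in> space M x \<Longrightarrow> w \<in> space M x \<Longrightarrow> v + w \<in> space M x"
    and pmodule_space_scal: "v \<in> space M x \<Longrightarrow> scal M c v \<in> space M x"
    and pmodule_space_diff: "v \<in> space M x \<Longrightarrow> w \<in> space M x \<Longrightarrow> v - w \<in> space M x"
proof -
  interpret vector_space "scal M"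
    by (rule pmodule_vector_space[OF M(1)])
  note S = pmodule_subspace[OF M]
  show "0 \<in> space M x" "v \<in> space M x \<Longrightarrow> w \<in> space M x \<Longrightarrow> v + w \<in> space M x"
    "v \<in> space M x \<Longrightarrow> scal M c v \<in> space M x"
    "v \<in> space M x \<Longrightarrow> w \<in> space M x \<Longrightarrow> v - w \<in> space M x"
    using S subspace_0 subspace_add subspace_scale subspace_diff by blast+
qed

lemma pmodule_act_zero:
  assumes "pmodule r M" "x \<in> Field r" "y \<in> Field r" "a \<in> inc_hom r x y"
  shows "act M y x a 0 = 0"
  using pmodule_act_add[OF assms, of 0 0] pmodule_space_zero[OF assms(1,2)] by simp

lemma pmodule_scal_zero_right: "pmodule r M \<Longrightarrow> scal M c 0 = 0"
  using vector_space.vector_space_assms(1)[OF pmodule_vector_space, of r M c 0 0] by simp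

text \<open>Natural transformations: the conditions in \<open>pmod_iso\<close> apart from
  bijectivity, separated out so that inclusions and projections of summands can be composed as
  well.\<close>

definition pmod_hom ::
  "'p rel \<Rightarrow> ('p, 'k::field, 'v::ab_group_add) pmod \<Rightarrow> ('p, 'k, 'w::ab_group_add) pmod \<Rightarrow>
   ('p \<Rightarrow> 'v \<Rightarrow> 'w) \<Rightarrow> bool"
  where
  "pmod_hom r M N \<phi> \<longleftrightarrow>
     (\<forall>x\<in>Field r. linear_between (scal M) (space M x) (scal N) (space N x) (\<phi> x)) \<and>
     (\<forall>x\<in>Field r. \<forall>y\<in>Field r. \<forall>a\<in>inc_hom r x y. \<forall>v\<in>space M x.
        \<phi> y (act M y x a v) = act N y x a (\<phi> x v))"

lemma pmod_iso_iff_hom: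
  "pmod_iso r M N \<longleftrightarrow>
     (\<exists>\<phi>. pmod_hom r M N \<phi> \<and> (\<forall>x\<in>Field r. bij_betw (\<phi> x) (space M x) (space N x)))"
  unfolding pmod_iso_def pmod_hom_def by (intro ex_cong1) blast

lemma pmod_homD:
  assumes "pmod_hom r M N \<phi>" "x \<in> Field r"
  shows pmod_hom_in: "v \<in> space M x \<Longrightarrow> \<phi> x v \<in> space N x"
    and pmod_hom_add: "v \<in> space M x \<Longrightarrow> w \<in> space M x \<Longrightarrow> \<phi> x (v + w) = \<phi> x v + \<phi> x w"
    and pmod_hom_scal: "v \<in> space M x \<Longrightarrow> \<phi> x (scal M c v) = scal N c (\<phi> x v)"
    and pmod_hom_act: "y \<in> Field r \<Longrightarrow> a \<in> inc_hom r x y \<Longrightarrow> v \<in> space M x \<Longrightarrow>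
      \<phi> y (act M y x a v) = act N y x a (\<phi> x v)"
  using assms unfolding pmod_hom_def linear_between_def image_subset_iff by auto

lemma pmod_hom_zero:
  assumes "pmodule r M" "pmod_hom r M N \<phi>" "x \<in> Field r"
  shows "\<phi> x 0 = 0"
  using pmod_hom_add[OF assms(2,3), of 0 0] pmodule_space_zero[OF assms(1,3)] by simp

lemma pmod_hom_sum:
  assumes M: "pmodule r M" and \<phi>: "pmod_hom r M N \<phi>" and x: "x \<in> Field r"
    and "finite A" "\<And>i. i \<in> A \<Longrightarrow> f i \<in> space M x"
  shows "\<phi> x (sum f A) = (\<Sum>i\<in>A. \<phi> x (f i)) \<and> sum f A \<in> space M x"
  using assms(4,5)
proof (induction A rule: finite_induct)
  case empty
  then show ?case
    using pmod_hom_zero[OF M \<phi> x] pmodule_space_zero[OF M x] by simp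
next
  case (insert i A)
  then show ?case
    using pmod_hom_add[OF \<phi> x] pmodule_space_add[OF M x] by simp
qed

lemma pmod_hom_comp:
  assumes "pmod_hom r M N \<phi>" "pmod_hom r N L \<psi>"
  shows "pmod_hom r M L (\<lambda>x v. \<psi> x (\<phi> x v))"
  using assms unfolding pmod_hom_def linear_between_def image_subset_iff
  by (intro conjI ballI allI) (simp_all)

lemma pmod_isoI:
  assumes "pmod_hom r M N \<phi>" "pmod_hom r N M \<psi>"
    and "\<And>x v. x \<in> Field r \<Longrightarrow> v \<in> space M x \<Longrightarrow> \<psi> x (\<phi> x v) = v"
    and "\<And>x v. x \<in> Field r \<Longrightarrow> v \<in> space N x \<Longrightarrow> \<phi> x (\<psi> x v) = v"
  shows "pmod_iso r M N"
  unfolding pmod_iso_iff_hom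
proof (intro exI conjI ballI)
  show "bij_betw (\<phi> x) (space M x) (space N x)" if x: "x \<in> Field r" for x
    by (rule bij_betw_byWitness[of _ "\<psi> x"])
      (use assms pmod_hom_in[OF assms(1) x] pmod_hom_in[OF assms(2) x] x in auto)
qed (rule assms(1))

text \<open>The pointwise inverse is again natural and linear: apply \<open>\<phi>\<close> to the
  candidate value, which lies in a space of \<open>M\<close>, and cancel. The module axioms are
  invoked for \<open>M\<close> alone, so \<open>N\<close> can be a direct sum not yet known to be a
  module.\<close>

lemma pmod_isoE:
  assumes M: "pmodule r M" and "pmod_iso r M N"
  obtains \<phi> \<psi> where "pmod_hom r M N \<phi>" "pmod_hom r N M \<psi>"
    "\<And>x v. x \<in> Field r \<Longrightarrow> v \<in> space M x \<Longrightarrow> \<psi> x (\<phi> x v) = v"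
    "\<And>x v. x \<in> Field r \<Longrightarrow> v \<in> space N x \<Longrightarrow> \<phi> x (\<psi> x v) = v"
proof -
  obtain \<phi> where \<phi>: "pmod_hom r M N \<phi>"
    and bij: "\<And>x. x \<in> Field r \<Longrightarrow> bij_betw (\<phi> x) (space M x) (space N x)"
    using assms(2) unfolding pmod_iso_iff_hom by blast
  define \<psi> where "\<psi> x = the_inv_into (space M x) (\<phi> x)" for x
  have 1: "\<psi> x (\<phi> x v) = v" if "x \<in> Field r" "v \<in> space M x" for x v
    using bij[OF that(1)] that(2) unfolding \<psi>_def bij_betw_def by (simp add: the_inv_into_f_f)
  have 2: "\<phi> x (\<psi> x v) = v" and in\<psi>: "\<psi> x v \<in> space M x" if "x \<in> Field r" "v \<in> space N x" for x v
  proof -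
    have "inj_on (\<phi> x) (space M x)" "v \<in> \<phi> x ` space M x"
      using bij[OF that(1)] that(2) unfolding bij_betw_def by auto
    then show "\<phi> x (\<psi> x v) = v" "\<psi> x v \<in> space M x"
      unfolding \<psi>_def by (simp_all add: f_the_inv_into_f the_inv_into_into)
  qed
  have "pmod_hom r N M \<psi>"
    unfolding pmod_hom_def linear_between_def
  proof (intro conjI ballI allI)
    fix x assume x: "x \<in> Field r"
    show "\<psi> x ` space N x \<subseteq> space M x"
      using in\<psi>[OF x] by blast
    fix v assume v: "v \<in> space N x"
    show "\<psi> x (v + w) = \<psi> x v + \<psi> x w" if w: "w \<in> space N x" for w
    proof -
      have "\<psi> x v + \<psi> x w = \<psi> x (\<phi> x (\<psi> x v + \<psi> x w))"
        by (rule 1[OF x, symmetric]) (intro pmodule_space_add[OF M x] in\<psi>[OF x] v w)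
      also have "\<phi> x (\<psi> x v + \<psi> x w) = v + w"
        by (simp add: pmod_hom_add[OF \<phi> x] in\<psi>[OF x] 2[OF x] v w)
      finally show ?thesis by simp
    qed
    show "\<psi> x (scal N c v) = scal M c (\<psi> x v)" for c
    proof -
      have "scal M c (\<psi> x v) = \<psi> x (\<phi> x (scal M c (\<psi> x v)))"
        by (rule 1[OF x, symmetric]) (intro pmodule_space_scal[OF M x] in\<psi>[OF x] v)
      also have "\<phi> x (scal M c (\<psi> x v)) = scal N c v"
        by (simp add: pmod_hom_scal[OF \<phi> x] in\<psi>[OF x] 2[OF x] v)
      finally show ?thesis by simp
    qed
    show "\<psi> y (act N y x a v) = act M y x a (\<psi> x v)" if y: "y \<in> Field r" and a: "a \<in> inc_hom r x y" for y a
    proof -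
      have "act M y x a (\<psi> x v) = \<psi> y (\<phi> y (act M y x a (\<psi> x v)))"
        by (rule 1[OF y, symmetric]) (intro pmodule_act_in[OF M x y a] in\<psi>[OF x] v)
      also have "\<phi> y (act M y x a (\<psi> x v)) = act N y x a v"
        by (simp add: pmod_hom_act[OF \<phi> x y a] in\<psi>[OF x] 2[OF x] v)
      finally show ?thesis by simp
    qed
  qed
  with \<phi> 1 2 show ?thesis
    using that by blast
qed

lemma pmod_iso_refl: "pmod_iso r M M"
  unfolding pmod_iso_iff_hom
  by (intro exI[of _ "\<lambda>x v. v"]) (auto simp: pmod_hom_def linear_between_def bij_betw_def)

lemma pmod_iso_sym:
  assumes "pmodule r M" "pmod_iso r M N"
  shows "pmod_iso r N M"
  using assms by (elim pmod_isoE) (auto intro: pmod_isoI)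

lemma pmod_iso_trans:
  assumes "pmod_iso r M N" "pmod_iso r N L"
  shows "pmod_iso r M L"
proof -
  obtain \<phi> \<psi> where *: "pmod_hom r M N \<phi>" "pmod_hom r N L \<psi>"
    and bij: "\<And>x. x \<in> Field r \<Longrightarrow> bij_betw (\<phi> x) (space M x) (space N x)"
      "\<And>x. x \<in> Field r \<Longrightarrow> bij_betw (\<psi> x) (space N x) (space L x)"
    using assms unfolding pmod_iso_iff_hom by blast
  have "bij_betw (\<lambda>v. \<psi> x (\<phi> x v)) (space M x) (space L x)" if "x \<in> Field r" for x
    using bij_betw_trans[OF bij(1)[OF that] bij(2)[OF that]] by (simp add: comp_def)
  with pmod_hom_comp[OF *] show ?thesis
    unfolding pmod_iso_iff_hom by blast
qed

text \<open>Finite dimension is the axiom that takes an argument: a maximal independent subset of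
  \<open>U x\<close> is no larger than a finite spanning set of \<open>space M x\<close>, and it
  spans \<open>U x\<close>.\<close>

lemma pmodule_submodule:
  assumes M: "pmodule r M"
    and sub: "\<And>x. x \<in> Field r \<Longrightarrow> U x \<subseteq> space M x"
    and U: "\<And>x. x \<in> Field r \<Longrightarrow> module.subspace (scal M) (U x)"
    and act: "\<And>x y a v. x \<in> Field r \<Longrightarrow> y \<in> Field r \<Longrightarrow> a \<in> inc_hom r x y \<Longrightarrow> v \<in> U x \<Longrightarrow> act M y x a v \<in> U y"
  shows "pmodule r (M\<lparr>space := U\<rparr>)"
proof -
  interpret vector_space "scal M"
    by (rule pmodule_vector_space[OF M])
  have fin: "\<exists>B. finite B \<and> U x = span B" if x: "x \<in> Field r" for x
  proof -
    obtain C where C: "finite C" "space M x = span C"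
      using pmodule_finite_span[OF M x] by blast
    obtain B where B: "B \<subseteq> U x" "independent B" "U x \<subseteq> span B"
      by (rule maximal_independent_subset)
    have "finite B"
      using independent_span_bound[OF C(1) B(2)] B(1) sub[OF x] C(2) by auto
    moreover have "span B \<subseteq> U x"
      using B(1) U[OF x] by (rule span_minimal)
    ultimately show ?thesis
      using B(3) by auto
  qed
  have sub': "v \<in> space M x" if "x \<in> Field r" "v \<in> U x" for x v
    using sub that by blast
  show ?thesis
    using M fin act sub' unfolding pmodule_def linear_between_def image_subset_iff
    by simp
qed

subsection \<open>Direct sums\<close>

lemma pmod_dsum_simps [simp]:
  "scal (pmod_dsum J F) c f i = scal (F i) c (f i)"
  "f \<in> space (pmod_dsum J F) x \<longleftrightarrow> (\<forall>i\<in>J. f i \<in> space (F i) x) \<and> (\<forall>i. i \<notin> J \<longrightarrow> f i = 0)"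
  "act (pmod_dsum J F) y x a f i = (if i \<in> J then act (F i) y x a (f i) else 0)"
  by (simp_all add: pmod_dsum_def)

text \<open>The inclusion of the \<open>i\<close>th summand into a direct sum;
  \<open>single i 1\<close> is a unit vector.\<close>

definition single :: "'i \<Rightarrow> 'v \<Rightarrow> 'i \<Rightarrow> 'v::zero" where
  "single i v = (\<lambda>j. if j = i then v else 0)"

lemma single_simps [simp]: "single i v i = v" "j \<noteq> i \<Longrightarrow> single i v j = 0"
  by (simp_all add: single_def)

lemma single_apply: "single i v j = (if j = i then v else 0)"
  by (simp add: single_def)

lemma single_zero: "single i 0 = 0"
  by (simp add: single_def fun_eq_iff)

lemma eq_sum_single:
  fixes f :: "'i \<Rightarrow> 'v::ab_group_add"
  assumes "finite T" "\<And>i. i \<notin> T \<Longrightarrow> f i = 0"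
  shows "f = (\<Sum>i\<in>T. single i (f i))"
proof
  fix j
  have "(\<Sum>i\<in>T. single i (f i)) j = (\<Sum>i\<in>T. single i (f i) j)"
    using assms(1) by (induction T rule: finite_induct) auto
  also have "\<dots> = (\<Sum>i\<in>T. if i = j then f i else 0)"
    by (intro sum.cong) (auto simp: single_apply)
  also have "\<dots> = f j"
    using assms by (simp add: sum.delta)
  finally show "f j = (\<Sum>i\<in>T. single i (f i)) j" by simp
qed

lemma vector_space_pointwise:
  assumes "\<And>i. vector_space (s i)"
  shows "vector_space (\<lambda>c f i. s i c (f i))"
  using assms unfolding vector_space_def by (simp add: fun_eq_iff)

text \<open>Every finitely supported family is the sum of its components, each spanned separately.
  This gives finite dimension of direct sums and, with \<open>B i = {1}\<close>, the standard basis
  of a coordinate space.\<close>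

lemma span_UN_single:
  assumes s: "\<And>i. vector_space (s i)" and T: "finite T"
  shows "module.span (\<lambda>c f i. s i c (f i)) (\<Union>i\<in>T. single i ` B i) =
    {f. (\<forall>i\<in>T. f i \<in> module.span (s i) (B i)) \<and> (\<forall>i. i \<notin> T \<longrightarrow> f i = 0)}" (is "_ = ?S")
proof -
  interpret P: vector_space "\<lambda>c f i. s i c (f i)"
    by (rule vector_space_pointwise[OF s])
  have mod: "module (s i)" for i
    using s by (simp add: module_iff_vector_space)
  note [simp] = module.scale_zero_right[OF mod]
  have z: "s i c (if j = i then v else 0) = (if j = i then s i c v else 0)" for i j c v
    by simp
  show ?thesis
  proof (rule antisym)
    show "P.span (\<Union>i\<in>T. single i ` B i) \<subseteq> ?S"
    proof (rule P.span_minimal)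
      show "(\<Union>i\<in>T. single i ` B i) \<subseteq> ?S"
        using mod by (auto simp: single_apply module.span_base module.span_zero)
      show "P.subspace ?S"
        using mod by (auto simp: P.subspace_def module.span_zero module.span_add module.span_scale)
    qed
    show "?S \<subseteq> P.span (\<Union>i\<in>T. single i ` B i)"
    proof
      fix f assume f: "f \<in> ?S"
      have "single i (f i) \<in> P.span (\<Union>i\<in>T. single i ` B i)" if i: "i \<in> T" for i
      proof -
        have "f i \<in> module.span (s i) (B i)"
          using f i by blast
        then show ?thesis
        proof (induction rule: module.span_induct_alt[OF mod, consumes 1])
          case 1
          show ?case
            unfolding single_zero by (rule P.span_zero)
        next
          case (2 c v w)
          have e: "single i (s i c v + w) = (\<lambda>j. s j c (single i v j)) + single i w"
            by (auto simp: single_def fun_eq_iff)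
          have m: "single i v \<in> P.span (\<Union>i\<in>T. single i ` B i)"
            using 2 i by (intro P.span_base) blast
          show ?case
            unfolding e by (intro P.span_add P.span_scale m 2(2))
        qed
      qed
      then have "(\<Sum>i\<in>T. single i (f i)) \<in> P.span (\<Union>i\<in>T. single i ` B i)"
        by (rule P.span_sum)
      moreover have "f = (\<Sum>i\<in>T. single i (f i))"
        using f T by (intro eq_sum_single) auto
      ultimately show "f \<in> P.span (\<Union>i\<in>T. single i ` B i)"
        by simp
    qed
  qed
qed

text \<open>All \<open>F i\<close> are taken to be modules, also for \<open>i\<close> outside
  \<open>T\<close>, because the scalar multiplication of the sum acts on every coordinate and has to
  make the whole function type a vector space.\<close>

lemma pmodule_dsum:
  assumes F: "\<And>i. pmodule r (F i)" and T: "finite T"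
  shows "pmodule r (pmod_dsum T F)"
proof -
  have scal: "scal (pmod_dsum T F) = (\<lambda>c f i. scal (F i) c (f i))"
    by (simp add: pmod_dsum_def)
  have V: "\<And>i. vector_space (scal (F i))"
    using F by (rule pmodule_vector_space)
  have "\<exists>B. finite B \<and> space (pmod_dsum T F) x = module.span (scal (pmod_dsum T F)) B"
    if x: "x \<in> Field r" for x
  proof -
    obtain B where B: "\<And>i. finite (B i)" "\<And>i. space (F i) x = module.span (scal (F i)) (B i)"
      using pmodule_finite_span[OF F x] by metis
    show ?thesis
    proof (intro exI conjI)
      show "finite (\<Union>i\<in>T. single i ` B i)"
        using T B by blast
      show "space (pmod_dsum T F) x = module.span (scal (pmod_dsum T F)) (\<Union>i\<in>T. single i ` B i)"
        unfolding scal span_UN_single[OF V T] using B(2) by (auto simp: pmod_dsum_def)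
    qed
  qed
  moreover have "vector_space (scal (pmod_dsum T F))"
    unfolding scal by (rule vector_space_pointwise[OF V])
  ultimately show ?thesis
    using F unfolding pmodule_def linear_between_def image_subset_iff
    by (simp add: fun_eq_iff pmodule_scal_zero_right[OF F])
qed

lemma pmod_hom_single:
  assumes F: "\<And>i. pmodule r (F i)" and "l \<in> T"
  shows "pmod_hom r (F l) (pmod_dsum T F) (\<lambda>x. single l)"
  using assms pmodule_space_zero[OF F] pmodule_act_zero[OF F]
  by (auto simp: pmod_hom_def linear_between_def single_apply fun_eq_iff pmodule_scal_zero_right[OF F])

lemma pmod_hom_component:
  assumes "l \<in> T"
  shows "pmod_hom r (pmod_dsum T F) (F l) (\<lambda>x f. f l)"
  using assms by (auto simp: pmod_hom_def linear_between_def)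

text \<open>
  The scalar multiplication of \<^const>\<open>pmod_dsum\<close> also involves the values of the family outside
  the index set, which may be junk.
\<close>

lemma pmod_iso_dsum_default:
  assumes M: "pmodule r M" and D: "pmodule r D" and iso: "pmod_iso r M (pmod_dsum T F)"
  shows "pmod_iso r M (pmod_dsum T (\<lambda>i. if i \<in> T then F i else D))" (is "pmod_iso r M ?N")
proof -
  \<comment> \<open>The spaces and the action depend only on the summands in \<open>T\<close>, so
    compatibility with scalars is all that has to be checked for the new family.\<close>
  have sp: "space ?N = space (pmod_dsum T F)" and ac: "act ?N = act (pmod_dsum T F)"
    by (auto simp: pmod_dsum_def fun_eq_iff)
  have "pmod_hom r M ?N \<phi>" if \<phi>: "pmod_hom r M (pmod_dsum T F) \<phi>" for \<phi>
  proof -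
    have "\<phi> x (scal M c v) = scal ?N c (\<phi> x v)" if x: "x \<in> Field r" and v: "v \<in> space M x" for x c v
    proof
      fix i
      have eq: "\<phi> x (scal M c v) = scal (pmod_dsum T F) c (\<phi> x v)"
        using \<phi> x v by (rule pmod_hom_scal)
      have "\<phi> x (scal M c v) i = 0" "\<phi> x v i = 0" if "i \<notin> T"
        using pmod_hom_in[OF \<phi> x] pmodule_space_scal[OF M x v] v that by auto
      then show "\<phi> x (scal M c v) i = scal ?N c (\<phi> x v) i"
        using eq by (cases "i \<in> T") (simp_all add: pmodule_scal_zero_right[OF D])
    qed
    then show ?thesis
      using \<phi> by (simp add: pmod_hom_def linear_between_def sp ac)
  qed
  then show ?thesis
    using iso unfolding pmod_iso_iff_hom sp by blast
qed

subsection \<open>Existence of decompositions into indecomposables\<close>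

text \<open>The maps \<open>g i\<close> separate the vectors: applied to a linear relation,
  \<open>g i\<close> kills all terms but that of \<open>v i\<close>, so the \<open>v i\<close> are
  independent. The \<open>g i\<close> are only additive on the span and may take values in any
  abelian group, so that components of module homomorphisms qualify as well as linear forms.\<close>

lemma (in vector_space) card_le_card_spanning:
  fixes g :: "'i \<Rightarrow> 'b \<Rightarrow> 'c::ab_group_add"
  assumes B: "finite B" and v: "\<And>i. i \<in> T \<Longrightarrow> v i \<in> span B"
    and add: "\<And>i u w. i \<in> T \<Longrightarrow> u \<in> span B \<Longrightarrow> w \<in> span B \<Longrightarrow> g i (u + w) = g i u + g i w"
    and off: "\<And>i j c. i \<in> T \<Longrightarrow> j \<in> T \<Longrightarrow> i \<noteq> j \<Longrightarrow> g i (c *s v j) = 0"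
    and diag: "\<And>i c. i \<in> T \<Longrightarrow> c \<noteq> 0 \<Longrightarrow> g i (c *s v i) \<noteq> 0"
  shows "card T \<le> card B"
proof -
  have inj: "inj_on v T"
  proof (rule inj_onI, rule ccontr)
    fix i j assume ij: "i \<in> T" "j \<in> T" "v i = v j" "i \<noteq> j"
    then have "g i (1 *s v j) = 0"
      by (intro off)
    moreover have "g i (1 *s v i) \<noteq> 0"
      using ij by (intro diag) simp_all
    ultimately show False
      using ij by simp
  qed
  have g0: "g i 0 = 0" if "i \<in> T" for i
    using add[OF that span_zero span_zero] by simp
  have "independent (v ` T)"
    unfolding independent_explicit_module
  proof (intro allI impI)
    fix t u w assume t: "finite t" "t \<subseteq> v ` T" "(\<Sum>w\<in>t. u w *s w) = 0" "w \<in> t"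
    then obtain i where i: "i \<in> T" "w = v i"
      by blast
    have "g i (\<Sum>w\<in>t. u w *s w) = (\<Sum>w\<in>t. g i (u w *s w)) \<and> (\<Sum>w\<in>t. u w *s w) \<in> span B"
      using t(1,2)
    proof (induction t rule: finite_induct)
      case empty
      then show ?case
        using g0[OF i(1)] span_zero by simp
    next
      case (insert a t)
      moreover have "u a *s a \<in> span B"
        using insert.prems v by (auto intro: span_scale)
      ultimately show ?case
        using add[OF i(1)] span_add by simp
    qed
    moreover have "g i (u b *s b) = (if b = w then g i (u w *s w) else 0)" if b: "b \<in> t" for b
      using t(2) b i off[OF i(1)] by auto
    then have "(\<Sum>b\<in>t. g i (u b *s b)) = (\<Sum>b\<in>t. if b = w then g i (u w *s w) else 0)"
      by (intro sum.cong refl)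
    then have "(\<Sum>b\<in>t. g i (u b *s b)) = g i (u w *s w)"
      using t(1,4) by simp
    ultimately have "g i (u w *s w) = 0"
      using t(3) g0[OF i(1)] by simp
    then show "u w = 0"
      using diag[OF i(1)] i(2) by blast
  qed
  then have "card (v ` T) \<le> card B"
    using independent_span_bound[OF B] v by blast
  then show ?thesis
    by (simp add: card_image[OF inj])
qed

text \<open>Choose a nonzero vector \<open>w i\<close> over a point \<open>p i\<close> in each
  summand. Those chosen over the same point stay independent in \<open>M\<close>, and summing over
  the points bounds the number of summands by the total size of the spanning sets.\<close>

lemma card_nonzero_summands_le:
  assumes M: "pmodule r M" and fin: "finite (Field r)" and T: "finite T"
    and F: "\<And>i. pmodule r (F i)" "\<And>i. i \<in> T \<Longrightarrow> \<not> pmod_zero r (F i)"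
    and iso: "pmod_iso r M (pmod_dsum T F)"
    and B: "\<And>x. x \<in> Field r \<Longrightarrow> finite (B x) \<and> space M x = module.span (scal M) (B x)"
  shows "card T \<le> (\<Sum>x\<in>Field r. card (B x))"
proof -
  interpret vector_space "scal M"
    by (rule pmodule_vector_space[OF M])
  obtain \<phi> \<psi> where \<phi>: "pmod_hom r M (pmod_dsum T F) \<phi>" and \<psi>: "pmod_hom r (pmod_dsum T F) M \<psi>"
    and inv: "\<And>x v. x \<in> Field r \<Longrightarrow> v \<in> space (pmod_dsum T F) x \<Longrightarrow> \<phi> x (\<psi> x v) = v"
    using pmod_isoE[OF M iso] by metis
  have "\<exists>x w. x \<in> Field r \<and> w \<in> space (F i) x \<and> w \<noteq> 0" if "i \<in> T" for i
    using F(2)[OF that] pmodule_space_zero[OF F(1)] unfolding pmod_zero_def by blast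
  then obtain p w where pw: "\<And>i. i \<in> T \<Longrightarrow> p i \<in> Field r \<and> w i \<in> space (F i) (p i) \<and> w i \<noteq> 0"
    by metis
  have le: "card {i \<in> T. p i = x} \<le> card (B x)" if x: "x \<in> Field r" for x
  proof (rule card_le_card_spanning[where v = "\<lambda>i. \<psi> x (single i (w i))" and g = "\<lambda>i u. \<phi> x u i"])
    have s: "single i (w i) \<in> space (pmod_dsum T F) x" if "i \<in> {i \<in> T. p i = x}" for i
      using pmod_hom_in[OF pmod_hom_single[where F = F, OF F(1)] x] pw that by blast
    have v: "\<psi> x (single i (w i)) \<in> space M x" if "i \<in> {i \<in> T. p i = x}" for i
      using pmod_hom_in[OF \<psi> x s[OF that]] .
    show "finite (B x)" and "\<And>i. i \<in> {i \<in> T. p i = x} \<Longrightarrow> \<psi> x (single i (w i)) \<in> span (B x)"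
      using B[OF x] v by auto
    show "\<phi> x (u + u') i = \<phi> x u i + \<phi> x u' i" if "u \<in> span (B x)" "u' \<in> span (B x)" for u u' i
      using that pmod_hom_add[OF \<phi> x] B[OF x] by simp
    have e: "\<phi> x (scal M c (\<psi> x (single j (w j)))) i = scal (F i) c (single j (w j) i)"
      if "j \<in> {i \<in> T. p i = x}" for i j c
      by (simp add: pmod_hom_scal[OF \<phi> x] v[OF that] inv[OF x s[OF that]])
    show "\<phi> x (scal M c (\<psi> x (single j (w j)))) i = 0"
      if "i \<in> {i \<in> T. p i = x}" "j \<in> {i \<in> T. p i = x}" "i \<noteq> j" for i j c
      using e[OF that(2)] that(3) by (simp add: pmodule_scal_zero_right[OF F(1)])
    show "\<phi> x (scal M c (\<psi> x (single i (w i)))) i \<noteq> 0"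
      if "i \<in> {i \<in> T. p i = x}" "c \<noteq> 0" for i c
    proof -
      interpret Fi: vector_space "scal (F i)"
        by (rule pmodule_vector_space[OF F(1)])
      show ?thesis
        using e[OF that(1)] pw that by simp
    qed
  qed
  have "T = (\<Union>x\<in>Field r. {i \<in> T. p i = x})"
    using pw by blast
  then have "card T \<le> (\<Sum>x\<in>Field r. card {i \<in> T. p i = x})"
    using card_UN_le[OF fin, of "\<lambda>x. {i \<in> T. p i = x}"] by simp
  also have "\<dots> \<le> (\<Sum>x\<in>Field r. card (B x))"
    using le by (rule sum_mono)
  finally show ?thesis .
qed

text \<open>\<open>G True\<close> takes the place of \<open>F k\<close>, and \<open>G False\<close>
  is appended at the new index \<open>n\<close>, so the other summands keep their indices.\<close>

lemma pmod_dsum_refine: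
  fixes F :: "nat \<Rightarrow> ('p, 'k::field, 'v::ab_group_add) pmod"
  assumes F: "\<And>i. pmodule r (F i)" and G: "\<And>b. pmodule r (G b)"
    and k: "k < n" and iso: "pmod_iso r (F k) (pmod_dsum UNIV G)"
  shows "pmod_iso r (pmod_dsum {..<n} F)
    (pmod_dsum {..<Suc n} (\<lambda>i. if i = k then G True else if i = n then G False else F i))"
    (is "pmod_iso r ?M (pmod_dsum _ ?F)")
proof -
  obtain \<phi> \<psi> where \<phi>: "pmod_hom r (F k) (pmod_dsum UNIV G) \<phi>"
    and \<psi>: "pmod_hom r (pmod_dsum UNIV G) (F k) \<psi>"
    and inv: "\<And>x v. x \<in> Field r \<Longrightarrow> v \<in> space (F k) x \<Longrightarrow> \<psi> x (\<phi> x v) = v"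
      "\<And>x v. x \<in> Field r \<Longrightarrow> v \<in> space (pmod_dsum UNIV G) x \<Longrightarrow> \<phi> x (\<psi> x v) = v"
    using pmod_isoE[OF F iso] by metis
  \<comment> \<open>The coordinates \<open>k\<close> and \<open>n\<close> of \<open>f\<close>, read
    as one element of the sum of \<open>G True\<close> and \<open>G False\<close>.\<close>
  let ?u = "\<lambda>f b. if b then f k else f n"
  define \<Phi> where "\<Phi> x f i = (if i = k then \<phi> x (f k) True else if i = n then \<phi> x (f k) False else f i)"
    for x and f :: "nat \<Rightarrow> 'v" and i
  define \<Psi> where "\<Psi> x f i = (if i = k then \<psi> x (?u f) else if i < n then f i else 0)"
    for x and f :: "nat \<Rightarrow> 'v" and i
  let ?N = "pmod_dsum {..<Suc n} ?F"
  have [simp]: "k \<noteq> n" "n \<noteq> k"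
    using k by auto
  have u: "?u f \<in> space (pmod_dsum UNIV G) x" if "f \<in> space ?N x" for f x
    using that k by (auto simp: split: if_splits)
  have fk: "f k \<in> space (F k) x" if "f \<in> space ?M x" for f x
    using that k by auto
  note z = pmodule_scal_zero_right[OF F]
  show ?thesis
  proof (rule pmod_isoI)
    show "pmod_hom r ?M ?N \<Phi>"
      unfolding pmod_hom_def linear_between_def image_subset_iff
    proof (intro conjI ballI allI)
      fix x f assume x: "x \<in> Field r" and f: "f \<in> space ?M x"
      note fk' = fk[OF f]
      have in': "\<phi> x (f k) b \<in> space (G b) x" for b
        using pmod_hom_in[OF \<phi> x fk'] by simp
      show "\<Phi> x f \<in> space ?N x"
        using f in' k by (auto simp: \<Phi>_def)
      show "\<Phi> x (f + g) = \<Phi> x f + \<Phi> x g" if g: "g \<in> space ?M x" for g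
        using pmod_hom_add[OF \<phi> x fk' fk[OF g]] by (auto simp: \<Phi>_def fun_eq_iff)
      show "\<Phi> x (scal ?M c f) = scal ?N c (\<Phi> x f)" for c
        using pmod_hom_scal[OF \<phi> x fk', of c] f by (auto simp: \<Phi>_def fun_eq_iff z)
      show "\<Phi> y (act ?M y x a f) = act ?N y x a (\<Phi> x f)" if y: "y \<in> Field r" and a: "a \<in> inc_hom r x y" for y a
        using pmod_hom_act[OF \<phi> x y a fk'] k by (auto simp: \<Phi>_def fun_eq_iff)
    qed
    show "pmod_hom r ?N ?M \<Psi>"
      unfolding pmod_hom_def linear_between_def image_subset_iff
    proof (intro conjI ballI allI)
      fix x f assume x: "x \<in> Field r" and f: "f \<in> space ?N x"
      note u' = u[OF f]
      show "\<Psi> x f \<in> space ?M x"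
        using f pmod_hom_in[OF \<psi> x u'] k by (auto simp: \<Psi>_def split: if_splits)
      show "\<Psi> x (f + g) = \<Psi> x f + \<Psi> x g" if g: "g \<in> space ?N x" for g
      proof -
        have "?u (f + g) = ?u f + ?u g"
          by (auto simp: fun_eq_iff)
        then have "\<psi> x (?u (f + g)) = \<psi> x (?u f) + \<psi> x (?u g)"
          using pmod_hom_add[OF \<psi> x u' u[OF g]] by (simp only:)
        then show ?thesis
          by (simp add: \<Psi>_def fun_eq_iff)
      qed
      show "\<Psi> x (scal ?N c f) = scal ?M c (\<Psi> x f)" for c
      proof -
        have "?u (scal ?N c f) = scal (pmod_dsum UNIV G) c (?u f)"
          by (auto simp: fun_eq_iff)
        then have "\<psi> x (?u (scal ?N c f)) = scal (F k) c (\<psi> x (?u f))"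
          using pmod_hom_scal[OF \<psi> x u', of c] by (simp only:)
        then show ?thesis
          by (simp add: \<Psi>_def fun_eq_iff z)
      qed
      show "\<Psi> y (act ?N y x a f) = act ?M y x a (\<Psi> x f)" if y: "y \<in> Field r" and a: "a \<in> inc_hom r x y" for y a
      proof -
        have "?u (act ?N y x a f) = act (pmod_dsum UNIV G) y x a (?u f)"
          using k by (auto simp: fun_eq_iff)
        then have "\<psi> y (?u (act ?N y x a f)) = act (F k) y x a (\<psi> x (?u f))"
          using pmod_hom_act[OF \<psi> x y a u'] by (simp only:)
        then show ?thesis
          using k by (simp add: \<Psi>_def fun_eq_iff)
      qed
    qed
    show "\<Psi> x (\<Phi> x f) = f" if x: "x \<in> Field r" and f: "f \<in> space ?M x" for x f
    proof -
      have "?u (\<Phi> x f) = \<phi> x (f k)"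
        by (auto simp: \<Phi>_def fun_eq_iff)
      then show ?thesis
        using inv(1)[OF x fk[OF f]] f by (auto simp: \<Psi>_def \<Phi>_def fun_eq_iff)
    qed
    show "\<Phi> x (\<Psi> x f) = f" if x: "x \<in> Field r" and f: "f \<in> space ?N x" for x f
      using inv(2)[OF x u[OF f]] f by (auto simp: \<Psi>_def \<Phi>_def fun_eq_iff less_Suc_eq)
  qed
qed

lemma pmod_iso_dsum_singleton:
  assumes M: "pmodule r M"
  shows "pmod_iso r M (pmod_dsum {..<Suc 0} (\<lambda>i. M))"
proof (rule pmod_isoI)
  show "pmod_hom r M (pmod_dsum {..<Suc 0} (\<lambda>i. M)) (\<lambda>x. single 0)"
    by (rule pmod_hom_single) (use M in simp_all)
  show "pmod_hom r (pmod_dsum {..<Suc 0} (\<lambda>i. M)) M (\<lambda>x f. f 0)"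
    by (rule pmod_hom_component) simp
qed (auto simp: single_apply fun_eq_iff)

lemma pmod_iso_dsum_empty:
  assumes M: "pmodule r M" "pmod_zero r M"
  shows "pmod_iso r M (pmod_dsum {} (\<lambda>i. M))"
proof -
  note z = pmodule_act_zero[OF M(1)] pmodule_scal_zero_right[OF M(1)]
  show ?thesis
    using M(2)
    by (intro pmod_isoI[of _ _ _ "\<lambda>x v i. 0" "\<lambda>x f. 0"])
      (auto simp: pmod_hom_def linear_between_def pmod_zero_def fun_eq_iff z)
qed

text \<open>A decomposition into nonzero modules with the largest possible number of summands cannot be refined.\<close>

lemma exists_indec_decomposition:
  fixes M :: "('p, 'k::field, 'v::ab_group_add) pmod"
  assumes M: "pmodule r M" and fin: "finite (Field r)"
  shows "\<exists>n F. indec_decomposition r M n F"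
proof -
  \<comment> \<open>Summands at indices from \<open>n\<close> on are also required to be modules,
    since they enter the scalar multiplication of \<open>pmod_dsum\<close>.\<close>
  define P where "P n \<longleftrightarrow> (\<exists>F :: nat \<Rightarrow> ('p, 'k, 'v) pmod. (\<forall>i. pmodule r (F i)) \<and>
    (\<forall>i<n. \<not> pmod_zero r (F i)) \<and> pmod_iso r M (pmod_dsum {..<n} F))" for n
  have ex: "\<exists>n. P n"
  proof (cases "pmod_zero r M")
    \<comment> \<open>The zero module gets the empty decomposition, as itself it would be a zero
      summand.\<close>
    case True
    then show ?thesis
      using M pmod_iso_dsum_empty[OF M] unfolding P_def by (intro exI[of _ 0] exI[of _ "\<lambda>_. M"]) simp
  next
    case False
    then show ?thesis
      using M pmod_iso_dsum_singleton[OF M] unfolding P_def by (intro exI[of _ "Suc 0"] exI[of _ "\<lambda>_. M"]) simp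
  qed
  obtain B where B: "\<And>x. x \<in> Field r \<Longrightarrow> finite (B x) \<and> space M x = module.span (scal M) (B x)"
    using pmodule_finite_span[OF M] by metis
  have bound: "n \<le> (\<Sum>x\<in>Field r. card (B x))" if "P n" for n
    using that card_nonzero_summands_le[OF M fin _ _ _ _ B, of "{..<n}"] unfolding P_def by auto
  obtain n where n: "P n" and max: "\<And>m. P m \<Longrightarrow> m \<le> n"
    using GreatestI_ex_nat[of P, OF ex] Greatest_le_nat[of P] bound by metis
  then obtain F :: "nat \<Rightarrow> ('p, 'k, 'v) pmod" where F: "\<And>i. pmodule r (F i)" "\<And>i. i < n \<Longrightarrow> \<not> pmod_zero r (F i)"
    and iso: "pmod_iso r M (pmod_dsum {..<n} F)"
    unfolding P_def by blast
  have "indecomposable r (F k)" if k: "k < n" for k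
    unfolding indecomposable_def
  proof (intro conjI allI impI F k)
    fix G :: "bool \<Rightarrow> ('p, 'k, 'v) pmod"
    assume G: "(\<forall>b. pmodule r (G b)) \<and> pmod_iso r (F k) (pmod_dsum UNIV G)"
    show "\<exists>b. pmod_zero r (G b)"
    proof (rule ccontr)
      assume nz: "\<not> (\<exists>b. pmod_zero r (G b))"
      have "pmod_iso r M (pmod_dsum {..<Suc n} (\<lambda>i. if i = k then G True else if i = n then G False else F i))"
        by (rule pmod_iso_trans[OF iso pmod_dsum_refine[OF F(1) _ k]]) (use G in blast)+
      then have "P (Suc n)"
        unfolding P_def
        by (intro exI[of _ "\<lambda>i. if i = k then G True else if i = n then G False else F i"])
          (use nz G F in \<open>auto simp: less_Suc_eq\<close>)
      then show False
        using max[of "Suc n"] by simp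
    qed
  qed
  then show ?thesis
    using iso unfolding indec_decomposition_def by blast
qed

subsection \<open>Interval modules and restriction\<close>

lemma interval_module_simps [simp]:
  "scal (interval_module I) = (*)"
  "space (interval_module I) x = (if x \<in> I then UNIV else {0})"
  "act (interval_module I) y x a v = (if x \<in> I \<and> y \<in> I then a * v else 0)"
  by (simp_all add: interval_module_def)

lemma vector_space_times: "vector_space ((*) :: 'k::field \<Rightarrow> 'k \<Rightarrow> 'k)"
  by unfold_locales (simp_all add: algebra_simps)

lemma span_times_one: "module.span ((*) :: 'k::field \<Rightarrow> 'k \<Rightarrow> 'k) {1} = UNIV"
proof -
  interpret vector_space "(*) :: 'k \<Rightarrow> 'k \<Rightarrow> 'k"
    by (rule vector_space_times)
  show ?thesis
    by (auto simp: span_singleton)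
qed

text \<open>Convexity gives functoriality: if \<open>x\<close> and \<open>z\<close> lie in
  \<open>I\<close> but \<open>y\<close> does not, then \<open>y\<close> is not between them, so one
  of the two coefficients is 0. The empty set is included and yields a zero module.\<close>

lemma pmodule_interval_module:
  assumes "convex_in r I"
  shows "pmodule r (interval_module I :: ('p, 'k::field, 'k) pmod)"
proof -
  interpret vector_space "(*) :: 'k \<Rightarrow> 'k \<Rightarrow> 'k"
    by (rule vector_space_times)
  have "\<exists>B. finite B \<and> space (interval_module I :: ('p, 'k, 'k) pmod) x = span B" for x
  proof (cases "x \<in> I")
    case True
    then show ?thesis
      by (intro exI[of _ "{1}"]) (simp add: span_times_one)
  next
    case False
    then show ?thesis
      by (intro exI[of _ "{}"]) simp
  qed
  moreover have "act (interval_module I) z x (b * a) v =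
      act (interval_module I) z y b (act (interval_module I) y x a v)"
    if "a \<in> inc_hom r x y" "b \<in> inc_hom r y z" for x y z and a b v :: 'k
  proof (cases "x \<in> I \<and> z \<in> I \<and> y \<notin> I")
    case True
    then have "a = 0 \<or> b = 0"
      using that assms unfolding convex_in_def inc_hom_def by (metis singletonD)
    with True show ?thesis
      by auto
  next
    case False
    then show ?thesis
      by auto
  qed
  ultimately show ?thesis
    unfolding pmodule_def linear_between_def image_subset_iff
    using vector_space_times[where 'k = 'k] by (simp add: distrib_left distrib_right)
qed

lemma pmod_restrict_simps [simp]:
  "scal (pmod_restrict f M) = scal M"
  "space (pmod_restrict f M) x = space M (f x)"
  "act (pmod_restrict f M) y x = act M (f y) (f x)"
  by (simp_all add: pmod_restrict_def)

lemma pmodule_restrict: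
  fixes M :: "('p, 'k::field, 'v::ab_group_add) pmod"
  assumes M: "pmodule r M" and f: "\<And>x y. (x, y) \<in> Q \<Longrightarrow> (f x, f y) \<in> r"
  shows "pmodule Q (pmod_restrict f M)"
proof -
  have "f x \<in> Field r" if "x \<in> Field Q" for x
    using that f by (auto simp: Field_def)
  moreover have "a \<in> inc_hom r (f x) (f y)" if "a \<in> inc_hom Q x y" for x y and a :: 'k
    using that f by (auto simp: inc_hom_def split: if_splits)
  ultimately show ?thesis
    using M unfolding pmodule_def by simp
qed

lemma pmod_restrict_dsum:
  "pmod_restrict f (pmod_dsum T F) = pmod_dsum T (\<lambda>i. pmod_restrict f (F i))"
  by (simp add: pmod_restrict_def pmod_dsum_def fun_eq_iff)

text \<open>Off \<open>T\<close> a summand enters the direct sum through its scalar multiplication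
  only.\<close>

lemma pmod_dsum_cong:
  assumes "\<And>i. scal (F i) = scal (G i)" "\<And>i. i \<in> T \<Longrightarrow> F i = G i"
  shows "pmod_dsum T F = pmod_dsum T G"
  using assms by (simp add: pmod_dsum_def fun_eq_iff)

subsection \<open>Multiplicity of the constant module on a connected poset\<close>

abbreviation constant_module :: "'p rel \<Rightarrow> ('p, 'k::field, 'k) pmod" where
  "constant_module r \<equiv> interval_module (Field r)"

text \<open>
  Homomorphisms from the constant module are the elements of the limit of \<open>F\<close>, homomorphisms to
  it are the linear forms on the colimit; the condition says that the map from the limit
  to the colimit is zero.
\<close>

definition limit_colimit_zero :: "'p rel \<Rightarrow> ('p, 'k::field, 'v::ab_group_add) pmod \<Rightarrow> bool" where
  "limit_colimit_zero r F \<longleftrightarrow>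
     (\<forall>s g. pmod_hom r (constant_module r) F s \<and> pmod_hom r F (constant_module r) g \<longrightarrow>
        (\<forall>x\<in>Field r. g x (s x 1) = 0))"

lemma pmodule_constant_module:
  "pmodule r (constant_module r :: ('p, 'k::field, 'k) pmod)"
  by (rule pmodule_interval_module) (auto simp: convex_in_def intro: FieldI1)

text \<open>Naturality equates the values at 1 at comparable points, and connectedness spreads this
  over the poset: an endomorphism is a single scalar. Having two points \<open>x\<close> and
  \<open>y\<close> allows that scalar to be computed wherever it is easiest, for instance where a
  composite vanishes.\<close>

lemma constant_endomorphism:
  fixes h :: "'p \<Rightarrow> 'k::field \<Rightarrow> 'k"
  assumes conn: "connected_in r (Field r)"
    and h: "pmod_hom r (constant_module r) (constant_module r) h"
    and x: "x \<in> Field r" and y: "y \<in> Field r"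
  shows "h x c = c * h y 1"
proof -
  have edge: "h a 1 = h b 1" if "(a, b) \<in> r" for a b
  proof -
    have ab: "a \<in> Field r" "b \<in> Field r" "(1 :: 'k) \<in> inc_hom r a b"
      using that by (auto simp: inc_hom_def intro: FieldI1 FieldI2)
    show ?thesis
      using pmod_hom_act[OF h ab, of 1] ab by simp
  qed
  have "(y, x) \<in> ((r \<union> r\<inverse>) \<inter> Field r \<times> Field r)\<^sup>*"
    using conn x y by (simp add: connected_in_def)
  then have "h x 1 = h y 1"
    by (induction rule: rtrancl_induct) (auto dest: edge)
  moreover have "h x c = c * h x 1"
    using pmod_hom_scal[OF h x, of 1 c] x by simp
  ultimately show ?thesis
    by simp
qed

text \<open>An isomorphism and its inverse would pair to 1 at any point. So the two alternatives of
  the dichotomy for indecomposables exclude each other.\<close>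

lemma limit_colimit_zero_not_constant:
  fixes F :: "('p, 'k::field, 'v::ab_group_add) pmod"
  assumes "limit_colimit_zero r F" "Field r \<noteq> {}" "pmodule r F"
  shows "\<not> pmod_iso r F (constant_module r)"
proof
  assume "pmod_iso r F (constant_module r)"
  then obtain g s where "pmod_hom r F (constant_module r) g" "pmod_hom r (constant_module r) F s"
    and inv: "\<And>x v. x \<in> Field r \<Longrightarrow> g x (s x v) = v"
    using pmod_isoE[OF assms(3)] by (smt (verit) UNIV_I interval_module_simps(2))
  then have "(1 :: 'k) = 0"
    using assms(1,2) unfolding limit_colimit_zero_def by (metis ex_in_conv)
  then show False by simp
qed

text \<open>A section \<open>s\<close> and a retraction \<open>g\<close> split \<open>F\<close> as the image of \<open>s\<close> plus the kernel of \<open>g\<close>.\<close>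

lemma indecomposable_constant_or_zero:
  fixes F :: "('p, 'k::field, 'v::ab_group_add) pmod"
  assumes conn: "connected_in r (Field r)" and F: "indecomposable r F"
  shows "pmod_iso r F (constant_module r) \<or> limit_colimit_zero r F"
proof (rule disjCI)
  let ?C = "constant_module r :: ('p, 'k, 'k) pmod"
  assume "\<not> limit_colimit_zero r F"
  then obtain s g0 x0 where s: "pmod_hom r ?C F s" and g0: "pmod_hom r F ?C g0"
    and x0: "x0 \<in> Field r" "g0 x0 (s x0 1) \<noteq> 0"
    unfolding limit_colimit_zero_def by blast
  \<comment> \<open>The composite of \<open>s\<close> and \<open>g0\<close> is a scalar, hence equal
    to the nonzero \<open>e\<close> everywhere; division by \<open>e\<close> turns \<open>g0\<close>
    into a left inverse of \<open>s\<close>.\<close>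
  define e where "e = g0 x0 (s x0 1)"
  define g where "g x v = g0 x v / e" for x v
  have M: "pmodule r F"
    using F by (simp add: indecomposable_def)
  interpret vector_space "scal F"
    by (rule pmodule_vector_space[OF M])
  have g: "pmod_hom r F ?C g"
    using g0 unfolding pmod_hom_def linear_between_def g_def by (simp add: add_divide_distrib)
  have gs: "g x (s x c) = c" if x: "x \<in> Field r" for x c
    using constant_endomorphism[OF conn pmod_hom_comp[OF s g0] x x0(1), of c] x0
    by (simp add: g_def e_def)
  define S where "S x = s x ` UNIV" for x
  define K where "K x = {v \<in> space F x. g x v = 0}" for x
  define G where "G b = F\<lparr>space := if b then S else K\<rparr>" for b
  note C = pmodule_constant_module[of r]
  note s_in = pmod_hom_in[OF s] and s_add = pmod_hom_add[OF s] and s_scal = pmod_hom_scal[OF s]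
    and s_act = pmod_hom_act[OF s]
  note g_add = pmod_hom_add[OF g] and g_scal = pmod_hom_scal[OF g] and g_act = pmod_hom_act[OF g]
  note sp = pmodule_space_zero[OF M] pmodule_space_add[OF M] pmodule_space_scal[OF M]
    pmodule_space_diff[OF M] pmodule_act_in[OF M]
  have s0: "s x 0 = 0" and g00: "g x 0 = 0" if "x \<in> Field r" for x
    using pmod_hom_zero[OF C s that] pmod_hom_zero[OF M g that] .
  have s_in': "s x c \<in> space F x" if "x \<in> Field r" for x c
    using s_in that by simp
  have s_add': "s x (c + d) = s x c + s x d" if "x \<in> Field r" for x c d
    using s_add that by simp
  have s_scal': "s x (c * d) = scal F c (s x d)" if "x \<in> Field r" for x c d
    using s_scal that by simp
  have s_act': "act F y x a (s x c) = s y (a * c)" if "x \<in> Field r" "y \<in> Field r" "a \<in> inc_hom r x y" for x y a c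
    using s_act[OF that(1) that(2,3), of c] that by simp
  have g_act': "g y (act F y x a v) = a * g x v"
    if "x \<in> Field r" "y \<in> Field r" "a \<in> inc_hom r x y" "v \<in> space F x" for x y a v
    using g_act[OF that] that by simp
  have g_diff: "g x (v - w) = g x v - g x w" if x: "x \<in> Field r" and v: "v \<in> space F x" "w \<in> space F x" for x v w
    using g_add[OF x sp(4)[OF x v] v(2)] by (simp add: algebra_simps)
  have act_diff: "act F y x a (v - w) = act F y x a v - act F y x a w"
    if x: "x \<in> Field r" "y \<in> Field r" "a \<in> inc_hom r x y" and v: "v \<in> space F x" "w \<in> space F x" for x y a v w
    using pmodule_act_add[OF M x sp(4)[OF x(1) v] v(2)] by (simp add: algebra_simps)
  have "pmodule r (F\<lparr>space := S\<rparr>)"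
  proof (rule pmodule_submodule[OF M])
    fix x assume x: "x \<in> Field r"
    show "S x \<subseteq> space F x"
      using s_in'[OF x] by (auto simp: S_def)
    show "subspace (S x)"
      unfolding subspace_def S_def
      using s0[OF x] s_add'[OF x, symmetric] s_scal'[OF x, symmetric] by (auto simp: image_iff)
    show "act F y x a v \<in> S y" if "y \<in> Field r" "a \<in> inc_hom r x y" "v \<in> S x" for y a v
      using that s_act'[OF x that(1,2)] by (auto simp: S_def)
  qed
  moreover have "pmodule r (F\<lparr>space := K\<rparr>)"
  proof (rule pmodule_submodule[OF M])
    fix x assume x: "x \<in> Field r"
    show "K x \<subseteq> space F x"
      by (auto simp: K_def)
    show "subspace (K x)"
      unfolding subspace_def K_def using g00[OF x] g_add[OF x] g_scal[OF x] sp[OF x] x by auto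
    show "act F y x a v \<in> K y" if "y \<in> Field r" "a \<in> inc_hom r x y" "v \<in> K x" for y a v
      using that g_act'[OF x that(1,2)] sp(5)[OF x that(1,2)] by (auto simp: K_def)
  qed
  ultimately have G: "pmodule r (G b)" for b
    by (cases b) (simp_all add: G_def)
  have "pmod_iso r F (pmod_dsum UNIV G)"
  proof (rule pmod_isoI)
    let ?\<phi> = "\<lambda>x v b. if b then s x (g x v) else v - s x (g x v)"
    let ?\<psi> = "\<lambda>x f. f True + f False"
    show "pmod_hom r F (pmod_dsum UNIV G) ?\<phi>"
      unfolding pmod_hom_def linear_between_def image_subset_iff
    proof (intro conjI ballI allI)
      fix x v assume x: "x \<in> Field r" and v: "v \<in> space F x"
      show "?\<phi> x v \<in> space (pmod_dsum UNIV G) x"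
        using x v s_in'[OF x] by (auto simp: G_def S_def K_def g_diff gs sp)
      show "?\<phi> x (v + w) = ?\<phi> x v + ?\<phi> x w" if w: "w \<in> space F x" for w
        using x v w by (auto simp: fun_eq_iff g_add s_add')
      show "?\<phi> x (scal F c v) = scal (pmod_dsum UNIV G) c (?\<phi> x v)" for c
        using x v by (auto simp: fun_eq_iff g_scal s_scal' G_def scale_right_diff_distrib)
      show "?\<phi> y (act F y x a v) = act (pmod_dsum UNIV G) y x a (?\<phi> x v)"
        if y: "y \<in> Field r" and a: "a \<in> inc_hom r x y" for y a
        using x v y a by (auto simp: fun_eq_iff g_act' s_act' G_def act_diff s_in')
    qed
    show "pmod_hom r (pmod_dsum UNIV G) F ?\<psi>"
      unfolding pmod_hom_def linear_between_def image_subset_iff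
    proof (intro conjI ballI allI)
      fix x f assume x: "x \<in> Field r" and f: "f \<in> space (pmod_dsum UNIV G) x"
      have f': "f True \<in> space F x" "f False \<in> space F x" if "f \<in> space (pmod_dsum UNIV G) x" for f
        using that s_in'[OF x] by (auto simp: G_def S_def K_def all_bool_eq)
      show "?\<psi> x f \<in> space F x"
        using f'[OF f] x sp by blast
      show "?\<psi> x (f + f') = ?\<psi> x f + ?\<psi> x f'" for f'
        by (simp add: algebra_simps)
      show "?\<psi> x (scal (pmod_dsum UNIV G) c f) = scal F c (?\<psi> x f)" for c
        by (simp add: G_def scale_right_distrib)
      show "?\<psi> y (act (pmod_dsum UNIV G) y x a f) = act F y x a (?\<psi> x f)"
        if y: "y \<in> Field r" and a: "a \<in> inc_hom r x y" for y a
        using pmodule_act_add[OF M x y a f'[OF f]] by (simp add: G_def)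
    qed
    show "?\<psi> x (?\<phi> x v) = v" for x v
      by simp
    show "?\<phi> x (?\<psi> x f) = f" if x: "x \<in> Field r" and f: "f \<in> space (pmod_dsum UNIV G) x" for x f
    proof -
      obtain c where c: "f True = s x c" and K: "f False \<in> space F x" "g x (f False) = 0"
        using f by (auto simp: G_def S_def K_def all_bool_eq)
      then have "g x (f True + f False) = c"
        using x by (simp add: g_add s_in' gs)
      then show ?thesis
        using c by (auto simp: fun_eq_iff)
    qed
  qed
  then obtain b where "pmod_zero r (G b)"
    using F G unfolding indecomposable_def by blast
  \<comment> \<open>The image of \<open>s\<close> is nonzero because \<open>g\<close> sends
    \<open>s x0 1\<close> to 1. So it is the kernel of \<open>g\<close> that vanishes, and
    \<open>g\<close> and \<open>s\<close> are mutually inverse.\<close>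
  moreover have "\<not> pmod_zero r (G True)"
  proof
    assume "pmod_zero r (G True)"
    then have "s x0 1 = 0"
      using x0(1) by (auto simp: pmod_zero_def G_def S_def)
    then show False
      using gs[OF x0(1), of 1] g00[OF x0(1)] by simp
  qed
  ultimately have zero: "K x = {0}" if "x \<in> Field r" for x
    using that by (cases b) (auto simp: pmod_zero_def G_def)
  have "s x (g x v) = v" if x: "x \<in> Field r" and v: "v \<in> space F x" for x v
  proof -
    have "v - s x (g x v) \<in> K x"
      using x v s_in'[OF x] by (simp add: K_def g_diff gs sp)
    then show ?thesis
      using zero[OF x] by simp
  qed
  with g s gs show "pmod_iso r F ?C"
    by (intro pmod_isoI[of _ _ _ g s]) auto
qed

text \<open>
  A matrix factorisation argument: the pairing of the inclusions and projections of the constant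
  summands in the first decomposition is an identity matrix, and expanding it along the second
  decomposition factors it through the constant summands there.
\<close>

lemma card_constant_summands_le:
  fixes N :: "('p, 'k::field, 'v::ab_group_add) pmod"
    and G :: "'i \<Rightarrow> ('p, 'k, 'w::ab_group_add) pmod" and G' :: "'j \<Rightarrow> ('p, 'k, 'u::ab_group_add) pmod"
  assumes conn: "connected_in r (Field r)" and ne: "Field r \<noteq> {}" and N: "pmodule r N"
    and T: "finite T" "\<And>i. pmodule r (G i)" "pmod_iso r N (pmod_dsum T G)"
    and T': "finite T'" "\<And>i. pmodule r (G' i)" "pmod_iso r N (pmod_dsum T' G')"
    and dich: "\<And>l. l \<in> T' \<Longrightarrow> pmod_iso r (G' l) (constant_module r) \<or> limit_colimit_zero r (G' l)"
  shows "card {i \<in> T. pmod_iso r (G i) (constant_module r)} \<le>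
    card {l \<in> T'. pmod_iso r (G' l) (constant_module r)}" (is "card ?A \<le> card ?A'")
proof -
  let ?C = "constant_module r :: ('p, 'k, 'k) pmod"
  \<comment> \<open>All pairings are evaluated at this one point; endomorphisms of the constant
    module are determined there.\<close>
  obtain x where x: "x \<in> Field r"
    using ne by blast
  obtain \<phi> \<psi> where \<phi>: "pmod_hom r N (pmod_dsum T G) \<phi>" and \<psi>: "pmod_hom r (pmod_dsum T G) N \<psi>"
    and \<phi>\<psi>: "\<And>x v. x \<in> Field r \<Longrightarrow> v \<in> space (pmod_dsum T G) x \<Longrightarrow> \<phi> x (\<psi> x v) = v"
    using pmod_isoE[OF N T(3)] by metis
  obtain \<phi>' \<psi>' where \<phi>': "pmod_hom r N (pmod_dsum T' G') \<phi>'" and \<psi>': "pmod_hom r (pmod_dsum T' G') N \<psi>'"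
    and \<psi>\<phi>': "\<And>x v. x \<in> Field r \<Longrightarrow> v \<in> space N x \<Longrightarrow> \<psi>' x (\<phi>' x v) = v"
    using pmod_isoE[OF N T'(3)] by metis
  define P where "P i \<gamma> \<sigma> \<longleftrightarrow> pmod_hom r (G i) ?C \<gamma> \<and> pmod_hom r ?C (G i) \<sigma> \<and>
    (\<forall>c. \<gamma> x (\<sigma> x c) = c)" for i \<gamma> \<sigma>
  have "\<exists>\<gamma> \<sigma>. P i \<gamma> \<sigma>" if "i \<in> ?A" for i
  proof -
    have "pmod_iso r (G i) ?C"
      using that by simp
    then obtain \<gamma> \<sigma> where "pmod_hom r (G i) ?C \<gamma>" "pmod_hom r ?C (G i) \<sigma>"
      "\<And>y c. y \<in> Field r \<Longrightarrow> c \<in> space ?C y \<Longrightarrow> \<gamma> y (\<sigma> y c) = c"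
      using pmod_isoE[OF T(2)] by metis
    then show ?thesis
      unfolding P_def using x by (intro exI[of _ \<gamma>] exI[of _ \<sigma>]) simp
  qed
  then obtain \<gamma> \<sigma> where "\<And>i. i \<in> ?A \<Longrightarrow> P i (\<gamma> i) (\<sigma> i)"
    by metis
  then have \<gamma>: "\<And>i. i \<in> ?A \<Longrightarrow> pmod_hom r (G i) ?C (\<gamma> i)"
    and \<sigma>: "\<And>i. i \<in> ?A \<Longrightarrow> pmod_hom r ?C (G i) (\<sigma> i)"
    and \<gamma>\<sigma>: "\<And>i c. i \<in> ?A \<Longrightarrow> \<gamma> i x (\<sigma> i x c) = c"
    unfolding P_def by blast+
  \<comment> \<open>The opposite inverse identity to that in \<open>P\<close>: there
    \<open>\<gamma>\<close> after \<open>\<sigma>\<close> must be the identity to make the pairing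
    an identity matrix, here \<open>\<rho>\<close> after \<open>\<tau>\<close> must be, to pass from
    a vector of \<open>G' l\<close> to the field and back.\<close>
  define P' where "P' l \<tau> \<rho> \<longleftrightarrow> pmod_hom r (G' l) ?C \<tau> \<and> pmod_hom r ?C (G' l) \<rho> \<and>
    (\<forall>w\<in>space (G' l) x. \<rho> x (\<tau> x w) = w)" for l \<tau> \<rho>
  have "\<exists>\<tau> \<rho>. P' l \<tau> \<rho>" if "l \<in> ?A'" for l
  proof -
    have "pmod_iso r (G' l) ?C"
      using that by simp
    then obtain \<tau> \<rho> where "pmod_hom r (G' l) ?C \<tau>" "pmod_hom r ?C (G' l) \<rho>"
      "\<And>y w. y \<in> Field r \<Longrightarrow> w \<in> space (G' l) y \<Longrightarrow> \<rho> y (\<tau> y w) = w"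
      using pmod_isoE[OF T'(2)] by metis
    then show ?thesis
      unfolding P'_def using x by (intro exI[of _ \<tau>] exI[of _ \<rho>]) simp
  qed
  then obtain \<tau> \<rho> where "\<And>l. l \<in> ?A' \<Longrightarrow> P' l (\<tau> l) (\<rho> l)"
    by metis
  then have \<tau>: "\<And>l. l \<in> ?A' \<Longrightarrow> pmod_hom r (G' l) ?C (\<tau> l)"
    and \<rho>: "\<And>l. l \<in> ?A' \<Longrightarrow> pmod_hom r ?C (G' l) (\<rho> l)"
    and \<rho>\<tau>: "\<And>l w. l \<in> ?A' \<Longrightarrow> w \<in> space (G' l) x \<Longrightarrow> \<rho> l x (\<tau> l x w) = w"
    unfolding P'_def by blast+
  \<comment> \<open>\<open>s j\<close> embeds the \<open>j\<close>th constant summand of the first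
    decomposition into \<open>N\<close>, and \<open>g i\<close> projects \<open>N\<close> onto the
    \<open>i\<close>th.\<close>
  define s where "s j y c = \<psi> y (single j (\<sigma> j y c))" for j y c
  define g where "g i y v = \<gamma> i y (\<phi> y v i)" for i y v
  have s: "pmod_hom r ?C N (s j)" if "j \<in> ?A" for j
    unfolding s_def
    by (rule pmod_hom_comp[OF pmod_hom_comp[OF \<sigma>[OF that] pmod_hom_single[of r G j T]] \<psi>])
      (use that T in auto)
  have g: "pmod_hom r N ?C (g i)" if "i \<in> ?A" for i
    unfolding g_def
    by (rule pmod_hom_comp[OF pmod_hom_comp[OF \<phi> pmod_hom_component[of i T r G]] \<gamma>[OF that]])
      (use that in auto)
  have s_in: "s j x 1 \<in> space N x" if "j \<in> ?A" for j
    using pmod_hom_in[OF s[OF that] x, of 1] x by simp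
  have pairing: "g i x (s j x 1) = (if i = j then 1 else 0)" if ij: "i \<in> ?A" "j \<in> ?A" for i j
  proof -
    have "\<sigma> j x 1 \<in> space (G j) x"
      using pmod_hom_in[OF \<sigma>[OF ij(2)] x, of 1] x by simp
    then have "single j (\<sigma> j x 1) \<in> space (pmod_dsum T G) x"
      using pmod_hom_in[OF pmod_hom_single[where F = G, OF T(2)] x, of j T] ij by blast
    then show ?thesis
      using ij \<phi>\<psi>[OF x] \<gamma>\<sigma> pmod_hom_zero[OF T(2) \<gamma>[OF ij(1)] x]
      by (simp add: s_def g_def single_apply)
  qed
  \<comment> \<open>\<open>a j l\<close> is the component of \<open>s j x 1\<close> in the
    \<open>l\<close>th summand of the second decomposition, and \<open>b i l\<close> is the value of
    \<open>g i\<close> on the generator of that summand when it is constant.\<close>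
  define a where "a j l = \<phi>' x (s j x 1) l" for j l
  define b where "b i l = g i x (\<psi>' x (single l (\<rho> l x 1)))" for i l
  have a_in: "a j l \<in> space (G' l) x" if "j \<in> ?A" "l \<in> T'" for j l
    using pmod_hom_in[OF \<phi>' x s_in[OF that(1)]] that(2) by (simp add: a_def)
  \<comment> \<open>A constant summand contributes a product of scalars. Any other one contributes
    0, as its \<open>a j l\<close> comes from a homomorphism out of the constant module and is sent
    on by one into it.\<close>
  have summand: "g i x (\<psi>' x (single l (a j l))) = (if l \<in> ?A' then b i l * \<tau> l x (a j l) else 0)"
    if ij: "i \<in> ?A" "j \<in> ?A" and l: "l \<in> T'" for i j l
  proof -
    have G'C: "pmod_hom r (G' l) ?C (\<lambda>y w. g i y (\<psi>' y (single l w)))"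
      by (rule pmod_hom_comp[OF pmod_hom_comp[OF pmod_hom_single[of r G' l T'] \<psi>'] g[OF ij(1)]]) (use T' l in auto)
    show ?thesis
    proof (cases "l \<in> ?A'")
      case True
      define c where "c = \<tau> l x (a j l)"
      have "a j l = \<rho> l x c"
        using \<rho>\<tau>[OF True a_in[OF ij(2) l]] by (simp add: c_def)
      moreover have "g i x (\<psi>' x (single l (\<rho> l x c))) = c * b i l"
        using constant_endomorphism[OF conn pmod_hom_comp[OF \<rho>[OF True] G'C] x x, of c]
        by (simp add: b_def)
      ultimately show ?thesis
        using True by (simp add: c_def)
    next
      case False
      then have "limit_colimit_zero r (G' l)"
        using dich l by blast
      moreover have "pmod_hom r ?C (G' l) (\<lambda>y c. \<phi>' y (s j y c) l)"
        by (rule pmod_hom_comp[OF pmod_hom_comp[OF s[OF ij(2)] \<phi>'] pmod_hom_component[OF l]])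
      ultimately show ?thesis
        using G'C x False unfolding limit_colimit_zero_def a_def by auto
    qed
  qed
  have expand: "g i x (s j x 1) = (\<Sum>l\<in>?A'. b i l * \<tau> l x (a j l))" if ij: "i \<in> ?A" "j \<in> ?A" for i j
  proof -
    have \<psi>'g: "pmod_hom r (pmod_dsum T' G') ?C (\<lambda>y f. g i y (\<psi>' y f))"
      by (rule pmod_hom_comp[OF \<psi>' g[OF ij(1)]])
    have single_in: "single l (a j l) \<in> space (pmod_dsum T' G') x" if l: "l \<in> T'" for l
      using pmod_hom_in[OF pmod_hom_single[where F = G', OF T'(2) l] x a_in[OF ij(2) l]] .
    have "\<phi>' x (s j x 1) = (\<Sum>l\<in>T'. single l (a j l))"
      unfolding a_def
      by (rule eq_sum_single[OF T'(1)]) (use pmod_hom_in[OF \<phi>' x s_in[OF ij(2)]] in simp)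
    then have "g i x (s j x 1) = g i x (\<psi>' x (\<Sum>l\<in>T'. single l (a j l)))"
      using \<psi>\<phi>'[OF x s_in[OF ij(2)]] by simp
    also have "\<dots> = (\<Sum>l\<in>T'. g i x (\<psi>' x (single l (a j l))))"
      using pmod_hom_sum[OF pmodule_dsum[where F = G', OF T'(2,1)] \<psi>'g x T'(1) single_in] by simp
    also have "\<dots> = (\<Sum>l\<in>T'. if l \<in> ?A' then b i l * \<tau> l x (a j l) else 0)"
      by (intro sum.cong refl summand ij)
    also have "\<dots> = (\<Sum>l\<in>?A'. b i l * \<tau> l x (a j l))"
      using T'(1) by (subst sum.inter_restrict[symmetric]) (auto intro: sum.cong)
    finally show ?thesis .
  qed
  have finA': "finite ?A'"
    using T'(1) by simp
  interpret V: vector_space "\<lambda>c (f :: 'j \<Rightarrow> 'k) l. c * f l"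
    by (rule vector_space_pointwise[OF vector_space_times])
  \<comment> \<open>The scalars \<open>\<tau> l x (a j l)\<close> form one vector for each
    \<open>j\<close> in \<open>?A\<close>, in the space spanned by the unit vectors of
    \<open>?A'\<close>. By \<open>expand\<close> and \<open>pairing\<close>, the rows of
    \<open>b\<close> are linear forms dual to these vectors.\<close>
  have "card ?A \<le> card (\<Union>l\<in>?A'. single l ` {1 :: 'k})"
  proof (rule V.card_le_card_spanning[where v = "\<lambda>j l. if l \<in> ?A' then \<tau> l x (a j l) else 0"
        and g = "\<lambda>i f. \<Sum>l\<in>?A'. b i l * f l"])
    show "finite (\<Union>l\<in>?A'. single l ` {1 :: 'k})"
      using finA' by simp
    show "(\<lambda>l. if l \<in> ?A' then \<tau> l x (a j l) else 0) \<in> V.span (\<Union>l\<in>?A'. single l ` {1 :: 'k})" for j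
      unfolding span_UN_single[OF vector_space_times finA'] span_times_one by auto
    show "(\<Sum>l\<in>?A'. b i l * (f + f') l) = (\<Sum>l\<in>?A'. b i l * f l) + (\<Sum>l\<in>?A'. b i l * f' l)" for i f f'
      by (simp add: algebra_simps sum.distrib)
    have *: "(\<Sum>l\<in>?A'. b i l * (c * (if l \<in> ?A' then \<tau> l x (a j l) else 0))) = c * (if i = j then 1 else 0)"
      if "i \<in> ?A" "j \<in> ?A" for i j c
    proof -
      have "(\<Sum>l\<in>?A'. b i l * (c * (if l \<in> ?A' then \<tau> l x (a j l) else 0))) =
        (\<Sum>l\<in>?A'. c * (b i l * \<tau> l x (a j l)))"
        by (intro sum.cong) auto
      also have "\<dots> = c * g i x (s j x 1)"
        by (simp add: expand[OF that] sum_distrib_left)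
      finally show ?thesis
        using pairing[OF that] by simp
    qed
    show "(\<Sum>l\<in>?A'. b i l * (c * (if l \<in> ?A' then \<tau> l x (a j l) else 0))) = 0"
      if "i \<in> ?A" "j \<in> ?A" "i \<noteq> j" for i j c
      using *[OF that(1,2)] that(3) by simp
    show "(\<Sum>l\<in>?A'. b i l * (c * (if l \<in> ?A' then \<tau> l x (a i l) else 0))) \<noteq> 0"
      if "i \<in> ?A" "c \<noteq> 0" for i c
      using *[OF that(1,1)] that(2) by simp
  qed
  also have "(\<Union>l\<in>?A'. single l ` {1 :: 'k}) = (\<lambda>l. single l 1) ` ?A'"
    by auto
  also have "card \<dots> \<le> card ?A'"
    by (rule card_image_le[OF finA'])
  finally show ?thesis .
qed

text \<open>Comparing \<open>G\<close> with a decomposition into indecomposables in both directions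
  shows that every such decomposition has the same count, which is therefore the value of
  \<open>THE\<close>. For the \<open>G i\<close> only the dichotomy is assumed, since restricted
  interval modules can be decomposable.\<close>

lemma multiplicity_in_constant:
  fixes N :: "('p, 'k::field, 'v::ab_group_add) pmod" and X :: "('p, 'k, 'k) pmod"
  assumes conn: "connected_in r (Field r)" and ne: "Field r \<noteq> {}" and fin: "finite (Field r)"
    and N: "pmodule r N" and X: "pmodule r X" "pmod_iso r X (constant_module r)"
    and T: "finite T" "\<And>i. pmodule r (G i)" "pmod_iso r N (pmod_dsum T G)"
      "\<And>i. i \<in> T \<Longrightarrow> pmod_iso r (G i) (constant_module r) \<or> limit_colimit_zero r (G i)"
  shows "multiplicity_in r X N = card {i \<in> T. pmod_iso r (G i) (constant_module r)}"
proof -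
  have count: "card {i. i < n \<and> pmod_iso r (F i) X} = card {i \<in> T. pmod_iso r (G i) (constant_module r)}"
    if F: "indec_decomposition r N n F" for n and F :: "nat \<Rightarrow> ('p, 'k, 'v) pmod"
  proof -
    have indec: "indecomposable r (F i)" if "i < n" for i
      using F that by (simp add: indec_decomposition_def)
    \<comment> \<open>Beyond \<open>n\<close> the family \<open>F\<close> is arbitrary;
      \<open>N\<close> serves as a default that is a module.\<close>
    define F' where "F' i = (if i \<in> {..<n} then F i else N)" for i
    have "pmod_iso r N (pmod_dsum {..<n} F')"
      unfolding F'_def by (rule pmod_iso_dsum_default[OF N N]) (use F in \<open>simp add: indec_decomposition_def\<close>)
    moreover have "pmodule r (F' i)" for i
      using N indec[of i] by (simp add: F'_def indecomposable_def)
    moreover have "pmod_iso r (F' i) (constant_module r) \<or> limit_colimit_zero r (F' i)" if "i \<in> {..<n}" for i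
      using that indecomposable_constant_or_zero[OF conn indec[of i]] by (simp add: F'_def)
    ultimately have "card {i \<in> {..<n}. pmod_iso r (F' i) (constant_module r)} =
        card {i \<in> T. pmod_iso r (G i) (constant_module r)}"
      using T by (intro antisym card_constant_summands_le[OF conn ne N]) auto
    moreover have "pmod_iso r (F i) X \<longleftrightarrow> pmod_iso r (F i) (constant_module r)" for i
      using pmod_iso_trans X pmod_iso_sym by blast
    then have "{i. i < n \<and> pmod_iso r (F i) X} = {i \<in> {..<n}. pmod_iso r (F' i) (constant_module r)}"
      by (auto simp: F'_def)
    ultimately show ?thesis
      by simp
  qed
  obtain n F where "indec_decomposition r N n F"
    using exists_indec_decomposition[OF N fin] by blast
  then show ?thesis
    unfolding multiplicity_in_def using count
    by (intro the_equality exI[of _ n] exI[of _ F]) auto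
qed

subsection \<open>Compression multiplicities of interval decomposable modules\<close>

lemma finite_interval_copies:
  assumes "finite (Field r)"
  shows "finite {(J, k). interval r J \<and> k < nat (d J)}"
proof -
  have "{(J, k). interval r J \<and> k < nat (d J)} = (SIGMA J:{J. interval r J}. {..<nat (d J)})"
    by auto
  then show ?thesis
    using finite_intervals[OF assms] by simp
qed

text \<open>A copy of the interval module of \<open>J\<close> counts once if
  \<open>I \<subseteq> J\<close> and not at all otherwise. The function \<open>d\<close> is kept
  general to serve both the positive and the negative part of the replacement.\<close>

lemma compression_mult_interval_dsum:
  fixes \<xi> :: "('p, 'q) csys" and d :: "'p set \<Rightarrow> int"
  assumes r: "Partial_order r" and fin: "finite (Field r)" and I: "interval r I"
    and \<xi>: "compression_system r \<xi>"
  shows "compression_mult \<xi> I (interval_dsum r d :: ('p, 'k::field, _) pmod) =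
    (\<Sum>J | interval r J \<and> I \<subseteq> J. nat (d J))"
proof -
  define Q where "Q = cposet \<xi> I"
  define f where "f = cmap \<xi> I"
  have Q: "Partial_order Q" "finite (Field Q)" "Field Q \<noteq> {}" "connected_in Q (Field Q)"
    and f: "\<And>x y. (x, y) \<in> Q \<Longrightarrow> (f x, f y) \<in> r" "f ` Field Q \<subseteq> I"
      "minimals r I \<union> maximals r I \<subseteq> f ` Field Q"
    using \<xi> I unfolding compression_system_def Q_def f_def by blast+
  define T where "T = {(J, k). interval r J \<and> k < nat (d J)}"
  define R where "R J = pmod_restrict f (interval_module J :: ('p, 'k, 'k) pmod)" for J
  \<comment> \<open>Pairs outside \<open>T\<close> may have a first component that is not convex;
    the zero module \<open>R {}\<close> replaces them.\<close>
  define G where "G i = (if i \<in> T then R (fst i) else R {})" for i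
  have N: "pmod_restrict f (interval_dsum r d) = pmod_dsum T G"
  proof -
    have "pmod_restrict f (interval_dsum r d) = pmod_dsum T (\<lambda>i. R (fst i))"
      unfolding interval_dsum_def pmod_restrict_dsum T_def R_def by (simp only: case_prod_beta)
    also have "\<dots> = pmod_dsum T G"
      by (rule pmod_dsum_cong) (simp_all add: G_def R_def)
    finally show ?thesis .
  qed
  have R: "pmodule Q (R J)" if "convex_in r J" for J
    unfolding R_def by (intro pmodule_restrict[where r = r] pmodule_interval_module that Q f)
  have G: "pmodule Q (G i)" for i
  proof (cases "i \<in> T")
    case True
    then have "convex_in r (fst i)"
      by (auto simp: T_def interval_def)
    with True show ?thesis
      by (simp add: G_def R)
  next
    case False
    have "convex_in r {}"
      by (simp add: convex_in_def)
    with False show ?thesis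
      by (simp add: G_def R)
  qed
  have T: "finite T"
    unfolding T_def by (rule finite_interval_copies[OF fin])
  have const: "pmod_iso Q (R J) (constant_module Q)" if "I \<subseteq> J" for J
    using that f(2)
    by (intro pmod_isoI[of _ _ _ "\<lambda>x v. v" "\<lambda>x v. v"])
      (auto simp: pmod_hom_def linear_between_def R_def)
  have zero: "limit_colimit_zero Q (R J)" if J: "interval r J" "\<not> I \<subseteq> J" for J
  proof -
    \<comment> \<open>At \<open>q\<close> the restricted module vanishes, so a composite through it
      is 0 at \<open>q\<close>, and being a scalar it is 0 everywhere.\<close>
    obtain q where q: "q \<in> Field Q" "f q \<notin> J"
      using interval_subset_if_extremes[OF r fin I J(1)] J(2) f(3) by blast
    have "g x (s x 1) = 0" if s: "pmod_hom Q (constant_module Q) (R J) s"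
      and g: "pmod_hom Q (R J) (constant_module Q) g" and x: "x \<in> Field Q" for s g x
    proof -
      have "s q 1 = 0"
        using pmod_hom_in[OF s q(1), of 1] q by (simp add: R_def)
      moreover have "g q 0 = 0"
        using J by (intro pmod_hom_zero[OF R g q(1)]) (simp add: interval_def)
      ultimately show ?thesis
        using constant_endomorphism[OF Q(4) pmod_hom_comp[OF s g] x q(1), of 1] by simp
    qed
    then show ?thesis
      unfolding limit_colimit_zero_def by blast
  qed
  have not_const: "\<not> pmod_iso Q (R J) (constant_module Q)" if J: "interval r J" "\<not> I \<subseteq> J" for J
    using limit_colimit_zero_not_constant[OF zero[OF J] Q(3)] R J by (simp add: interval_def)
  have GT: "G i = R (fst i)" "interval r (fst i)" if "i \<in> T" for i
    using that by (auto simp: G_def T_def)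
  have "compression_mult \<xi> I (interval_dsum r d :: ('p, 'k, _) pmod) = multiplicity_in Q (R I) (pmod_dsum T G)"
    unfolding compression_mult_def Q_def[symmetric] f_def[symmetric] N R_def ..
  also have "\<dots> = card {i \<in> T. pmod_iso Q (G i) (constant_module Q)}"
  proof (rule multiplicity_in_constant[OF Q(4,3,2)])
    show "pmodule Q (R I)"
      using I by (intro R) (simp add: interval_def)
    show "pmod_iso Q (G i) (constant_module Q) \<or> limit_colimit_zero Q (G i)" if "i \<in> T" for i
      using GT[OF that] const zero by (cases "I \<subseteq> fst i") simp_all
  qed (auto intro: pmodule_dsum G T const pmod_iso_refl)
  also have "{i \<in> T. pmod_iso Q (G i) (constant_module Q)} =
    (SIGMA J:{J. interval r J \<and> I \<subseteq> J}. {..<nat (d J)})"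
  proof -
    have "pmod_iso Q (G i) (constant_module Q) \<longleftrightarrow> I \<subseteq> fst i" if "i \<in> T" for i
      using GT[OF that] const not_const by auto
    then have "{i \<in> T. pmod_iso Q (G i) (constant_module Q)} = {i \<in> T. I \<subseteq> fst i}"
      by auto
    then show ?thesis
      by (auto simp: T_def)
  qed
  also have "card \<dots> = (\<Sum>J | interval r J \<and> I \<subseteq> J. nat (d J))"
    by (subst card_SigmaI) (use finite_intervals[OF fin] in simp_all)
  finally show ?thesis .
qed

theorem mainTheorem1:
  fixes r :: "'p rel"
    and M :: "('p, 'k::field, 'v::ab_group_add) pmod"
    and I :: "'p set"
    and \<xi> :: "('p, 'q) csys"
  assumes "Partial_order r"
    and "finite (Field r)"
    and "pmodule r M"
    and "interval r I"
  shows "(compression_system r \<xi> \<longrightarrow>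
            virtual_mult \<xi> I (interval_replacement r \<xi> M) = int (compression_mult \<xi> I M)) \<and>
         (rank_compression_system r \<xi> \<longrightarrow>
            virtual_rank \<xi> I (interval_replacement r \<xi> M) = int (compression_rank \<xi> I M))"
proof -
  have main: "virtual_mult \<xi> I (interval_replacement r \<xi> M) = int (compression_mult \<xi> I M)"
    if \<xi>: "compression_system r \<xi>"
  proof -
    let ?\<delta> = "signed_interval_mult r \<xi> M"
    note count = compression_mult_interval_dsum[OF assms(1,2,4) \<xi>, where 'k = 'k]
    have "virtual_mult \<xi> I (interval_replacement r \<xi> M) =
      (\<Sum>J | interval r J \<and> I \<subseteq> J. int (nat (?\<delta> J)) - int (nat (- ?\<delta> J)))"
      by (simp add: virtual_mult_def interval_replacement_def count sum_subtractf)
    also have "\<dots> = (\<Sum>J | interval r J \<and> I \<subseteq> J. ?\<delta> J)"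
      by (intro sum.cong) auto
    also have "\<dots> = int (compression_mult \<xi> I M)"
      unfolding signed_interval_mult_def
      using sum_cover_signs_above[OF assms(1,2,4), of "\<lambda>L. int (compression_mult \<xi> L M)"] .
    finally show ?thesis .
  qed
  \<comment> \<open>Ranks are multiplicities by definition, so the second claim is the first one for
    the underlying compression system.\<close>
  moreover have "virtual_rank \<xi> I D = virtual_mult \<xi> I D" "compression_rank \<xi> I M = compression_mult \<xi> I M"
    for D :: "('p, 'k, 'p set \<times> nat \<Rightarrow> 'k) pmod \<times> ('p, 'k, 'p set \<times> nat \<Rightarrow> 'k) pmod"
    by (simp_all add: virtual_rank_def virtual_mult_def compression_rank_def)
  ultimately show ?thesis
    by (simp add: rank_compression_system_def)
qed

end
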